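(* Let $\mathcal{B}$ be a Cosserat medium and $\overline{\Omega}(\mathcal{B})$ its second-order non-holonomic material groupoid. If $\mathcal{B}$ is homogeneous, then $\overline{\Omega}(\mathcal{B})$ is a second-order non-holonomic integrable prolongation. In fact, $\overline{\Omega}(\mathcal{B})$ is a second-order non-holonomic integrable prolongation if, and only if, $\mathcal{B}$ is locally homogeneous.
   Context: Frame bundles. For an $n$-manifold $M$, $FM\to M$ is the linear frame bundle with its right action of $Gl(n,\mathbb R)$; a frame at $x$ is a $1$-jet $j^1_{0,x}\phi$ of a local diffeomorphism $\phi:\mathbb R^n\to M$ with $\phi(0)=x$. For a local diffeomorphism $\psi$, $F\psi(j^1_{0,\phi(0)}\phi)=j^1_{0,\psi(\phi(0))}(\psi\circ\phi)$. $\tau_v$ is translation of $\mathbb R^n$ by $v$. A local principal bundle isomorphism is a diffeomorphism $\Psi:FU\to FV$ with $\Psi(z\cdot g)=\Psi(z)\cdot g$; it induces $\psi:U\to V$. Groupoids. $\Pi^1(M,M)\rightrightarrows M$ is the groupoid of $1$-jets $j^1_{x,y}\psi$ of local diffeomorphisms (equivalently linear isomorphisms $T_xM\to T_yM$), with source $\alpha$ and target $\beta$. $\tilde J^1(FM)\rightrightarrows M$ is the quotient of the groupoid of $1$-jets $j^1_{X,Y}\Psi$ of local principal bundle isomorphisms of $FM$ by the action $j^1_{X,Y}\Psi\cdot g=j^1_{X\cdot g,Y\cdot g}\Psi$ of $Gl(n,\mathbb R)$; the class of $j^1_{X,Y}\Psi$, with $X$ over $x$ and $Y$ over $y$, is written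 $j^1_{x,y}\Psi$; its source is $\overline\alpha(j^1_{x,y}\Psi)=x$ and its target is $\overline\beta(j^1_{x,y}\Psi)=y$. A reduced Lie subgroupoid of a Lie groupoid over $M$ is a transitive Lie subgroupoid whose base is all of $M$. Cosserat media. A body $\mathcal B$ is a $3$-manifold covered by one chart; a Cosserat medium is $F\mathcal B$ (and $\mathcal B$ is called the Cosserat continuum). A configuration is an embedding of principal bundles $F\mathcal B\to F\mathbb R^3$ over the identity of $Gl(3,\mathbb R)$. A reference configuration is fixed and $F\mathcal B$ is identified with its image, so $\mathcal B\subseteq\mathbb R^3$ is open. A deformation is an embedding of principal bundles $\tilde\kappa:F\mathcal B\to F\mathbb R^3$ over the identity of $Gl(3,\mathbb R)$, with induced map $\kappa:\mathcal B\to\mathbb R^3$; $j^1_{y,\kappa(y)}\tilde\kappa$ is an infinitesimal deformation at $y$. The mechanical response is a differentiable map $W:\tilde J^1(F\mathcal B)\to V$ ($V$ a real vector space) with $W(j^1_{x,y}\Psi)=W(j^1_{x,z}(F\tau_{z-y}\circ\Psi))$; by this property $W$ is also defined on elements of $\tilde J^1(F\mathbb R^3)$ with source in $\mathcal B$. The material groupoid $\overline\Omega(\mathcal B)$ consists of the $j^1_{x,y}\Psi\in\tilde J^1(F\mathcal B)$ with $W(j^1_{y,\kappa(y)}\tilde\kappa\cdot j^1_{x,y}\Psi)=W(j^1_{y,\kappa(y)}\tilde\kappa)$ for all infinitesimal deformations at $y$. Standing assumption: $\overline\Omega(\mathcal B)$ is a Lie subgroupoid of $\tilde J^1(F\mathcal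 B)$. Homogeneity. $\mathcal B$ is homogeneous if there is a global deformation $\tilde\kappa$ such that for all $x,y\in\mathcal B$ the element $j^1_{x,y}(\tilde\kappa^{-1}\circ F\tau_{\kappa(y)-\kappa(x)}\circ\tilde\kappa)$ belongs to $\overline\Omega(\mathcal B)$. An open set $U\subseteq\mathcal B$ is homogeneous if the same holds with a deformation $\tilde\kappa$ defined over $U$ and $x,y\in U$. $\mathcal B$ is locally homogeneous if it is covered by homogeneous open sets. Prolongations. For an open $U\subseteq M$, a section of $(\alpha,\beta)$ (resp. $(\overline\alpha,\overline\beta)$) over $U\times U$ is a smooth map $U\times U\to\Pi^1(U,U)$ (resp. $\tilde J^1(FU)$) that is a right inverse of $(\alpha,\beta)$ (resp. $(\overline\alpha,\overline\beta)$). Given sections $\mathcal P,\mathcal Q$ of $(\alpha,\beta)$ with $\mathcal Q(x,y)=j^1_{x,y}\psi_{xy}$, the second-order non-holonomic prolongation $\mathcal P^1(\mathcal Q)$ is the section of $(\overline\alpha,\overline\beta)$ given by $\mathcal P^1(\mathcal Q)(x,y)=j^1_{x,y}(\overline{\mathcal P\circ\psi_{xy}})$, where $\overline{\mathcal P\circ\psi_{xy}}(j^1_{0,f(0)}f)=\mathcal P(f(0),\psi_{xy}(f(0)))\cdot j^1_{0,f(0)}f$. It is an integrable prolongation if $\mathcal Q$ is integrable, i.e. for all $x_0,y_0\in U$ there are charts $\psi_1,\psi_2$ of $U$ around $x_0$ and $y_0$ with $\mathcal Q(x,y)=j^1_{x,y}(\psi_2^{-1}\circ\tau_{\psi_2(y)-\psi_1(x)}\circ\psi_1)$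 for $x,y$ in the respective chart domains. A reduced Lie subgroupoid of $\tilde J^1(FM)$ is a (second-order non-holonomic) integrable prolongation if $M$ can be covered by open sets $U$ each carrying an integrable prolongation over $U\times U$ with values in the subgroupoid.
   Formalization: That an integrable prolongation implies local homogeneity is proved only for sections P with P(y,z)P(x,y)=P(x,z), as it fails for arbitrary P; the equivalence is stated for B connected or the material groupoid transitive, since local homogeneity alone does not give transitivity. *)

theory Defs
  imports "HOL-Analysis.Analysis"
begin

section \<open>Smooth maps and diffeomorphisms between open sets\<close>

text \<open>
  \<open>Ck_on k S f\<close> is used for open \<open>S\<close> only. In finite dimension, continuity of all iterated
  directional derivatives (of a map differentiable at each stage) is the usual notion of \<open>C\<^sup>k\<close>.
\<close>

primrec Ck_on :: "nat \<Rightarrow> 'a::euclidean_space set \<Rightarrow> ('a \<Rightarrow> 'b::real_normed_vector) \<Rightarrow> bool" where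
  "Ck_on 0 S f \<longleftrightarrow> continuous_on S f"
| "Ck_on (Suc k) S f \<longleftrightarrow>
     (\<forall>x\<in>S. f differentiable (at x)) \<and> (\<forall>v. Ck_on k S (\<lambda>x. frechet_derivative f (at x) v))"

definition smooth_on :: "'a::euclidean_space set \<Rightarrow> ('a \<Rightarrow> 'b::real_normed_vector) \<Rightarrow> bool" where
  "smooth_on S f \<longleftrightarrow> (\<forall>k. Ck_on k S f)"

definition diffeo_on ::
  "'a::euclidean_space set \<Rightarrow> 'b::euclidean_space set \<Rightarrow> ('a \<Rightarrow> 'b) \<Rightarrow> bool" where
  "diffeo_on S T f \<longleftrightarrow> open S \<and> open T \<and> bij_betw f S T \<and>
     smooth_on S f \<and> smooth_on T (inv_into S f)"


section \<open>The groupoid of 1-jets of local diffeomorphisms\<close>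

type_synonym point = "real^3"
type_synonym pjet = "point \<times> point \<times> (real^3^3)"

text \<open>The 1-jet \<open>j\<^sup>1\<^bsub>x,\<psi>(x)\<^esub>\<psi>\<close>: source, target, and Jacobian matrix.\<close>

definition j1 :: "point \<Rightarrow> (point \<Rightarrow> point) \<Rightarrow> pjet" where
  "j1 x \<psi> = (x, \<psi> x, matrix (frechet_derivative \<psi> (at x)))"

definition represents :: "point set \<Rightarrow> (point \<Rightarrow> point) \<Rightarrow> pjet \<Rightarrow> bool" where
  "represents U \<psi> p \<longleftrightarrow>
     (\<exists>V V'. diffeo_on V V' \<psi> \<and> V \<subseteq> U \<and> V' \<subseteq> U \<and> fst p \<in> V \<and> j1 (fst p) \<psi> = p)"

definition Pi1 :: "point set \<Rightarrow> pjet set" where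
  "Pi1 U = {p. \<exists>\<psi>. represents U \<psi> p}"

fun pi1_comp :: "pjet \<Rightarrow> pjet \<Rightarrow> pjet" where
  "pi1_comp (y', z, A') (x, y, A) = (x, z, A' ** A)"


section \<open>Frame bundles of open subsets of three-space\<close>

text \<open>
  The frame \<open>j\<^sup>1\<^bsub>0,x\<^esub>\<phi>\<close> is the pair of \<open>x = \<phi>(0)\<close> and the (invertible) Jacobian matrix of \<open>\<phi>\<close>
  at 0; \<open>FB U\<close> is thus an open subset of the vector space \<open>frame\<close>.
\<close>

type_synonym frame = "point \<times> (real^3^3)"

definition FB :: "point set \<Rightarrow> frame set" where
  "FB U = U \<times> {A. invertible A}"

definition frame_act :: "frame \<Rightarrow> real^3^3 \<Rightarrow> frame" (infixl \<open>\<cdot>\<close> 75) where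
  "z \<cdot> g = (fst z, snd z ** g)"

definition Fmap :: "(point \<Rightarrow> point) \<Rightarrow> frame \<Rightarrow> frame" where
  "Fmap \<psi> z = (\<psi> (fst z), matrix (frechet_derivative \<psi> (at (fst z))) ** snd z)"

definition transl :: "point \<Rightarrow> point \<Rightarrow> point" where
  "transl v = (\<lambda>u. u + v)"

fun pjet_act :: "pjet \<Rightarrow> frame \<Rightarrow> frame" where
  "pjet_act (x, y, A) (x', Z) = (y, A ** Z)"

definition equivariant_on :: "point set \<Rightarrow> (frame \<Rightarrow> frame) \<Rightarrow> bool" where
  "equivariant_on U \<Psi> \<longleftrightarrow> (\<forall>z\<in>FB U. \<forall>g. invertible g \<longrightarrow> \<Psi> (z \<cdot> g) = \<Psi> z \<cdot> g)"

definition base_map :: "(frame \<Rightarrow> frame) \<Rightarrow> point \<Rightarrow> point" where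
  "base_map \<Psi> x = fst (\<Psi> (x, mat 1))"

definition local_pb_iso :: "point set \<Rightarrow> point set \<Rightarrow> (frame \<Rightarrow> frame) \<Rightarrow> bool" where
  "local_pb_iso U V \<Psi> \<longleftrightarrow>
     open U \<and> open V \<and> diffeo_on (FB U) (FB V) \<Psi> \<and> equivariant_on U \<Psi>"

text \<open>Embedding: an immersion that is a homeomorphism onto its image.\<close>

definition pb_embedding :: "point set \<Rightarrow> (frame \<Rightarrow> frame) \<Rightarrow> bool" where
  "pb_embedding U \<kappa> \<longleftrightarrow>
     open U \<and> \<kappa> ` FB U \<subseteq> FB UNIV \<and> equivariant_on U \<kappa> \<and> smooth_on (FB U) \<kappa> \<and>
     (\<forall>z\<in>FB U. inj (frechet_derivative \<kappa> (at z))) \<and>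
     (\<exists>g. homeomorphism (FB U) (\<kappa> ` FB U) \<kappa> g)"


section \<open>The groupoid of reduced 1-jets of principal bundle isomorphisms\<close>

type_synonym frame_jet = "frame \<times> frame \<times> (frame \<Rightarrow> frame)"
type_synonym reduced_jet = "frame_jet set"

definition fjet :: "frame \<Rightarrow> (frame \<Rightarrow> frame) \<Rightarrow> frame_jet" where
  "fjet X \<Psi> = (X, \<Psi> X, frechet_derivative \<Psi> (at X))"

text \<open>
  \<open>rjet x \<Psi>\<close> is the class \<open>j\<^sup>1\<^bsub>x,\<psi>(x)\<^esub>\<Psi>\<close>, that is, the orbit of \<open>fjet X \<Psi>\<close>, \<open>X\<close> over \<open>x\<close>, under the
  action \<open>(fjet X \<Psi>)\<cdot>g = fjet (X \<cdot> g) \<Psi>\<close>.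
\<close>

definition rjet :: "point \<Rightarrow> (frame \<Rightarrow> frame) \<Rightarrow> reduced_jet" where
  "rjet x \<Psi> = {fjet ((x, mat 1) \<cdot> g) \<Psi> | g. invertible g}"

definition Jt :: "point set \<Rightarrow> reduced_jet set" where
  "Jt M = {rjet x \<Psi> | x \<Psi> U V. local_pb_iso U V \<Psi> \<and> U \<subseteq> M \<and> V \<subseteq> M \<and> x \<in> U}"

definition src :: "reduced_jet \<Rightarrow> point" where
  "src c = (THE x. \<exists>A Y L. ((x, A), Y, L) \<in> c)"

definition tgt :: "reduced_jet \<Rightarrow> point" where
  "tgt c = (THE y. \<exists>X A L. (X, (y, A), L) \<in> c)"

definition jcomp :: "reduced_jet \<Rightarrow> reduced_jet \<Rightarrow> reduced_jet" (infixl \<open>\<odot>\<close> 70) where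
  "d \<odot> c = {(X, Z, K \<circ> L) | X Y Z K L. (X, Y, L) \<in> c \<and> (Y, Z, K) \<in> d}"

definition jinv :: "reduced_jet \<Rightarrow> reduced_jet" where
  "jinv c = {(Y, X, inv L) | X Y L. (X, Y, L) \<in> c}"

definition jid :: "point \<Rightarrow> reduced_jet" where
  "jid x = rjet x id"

text \<open>
  Global chart of \<open>Jt UNIV\<close>. A bundle isomorphism has the form \<open>\<Psi> (u, Z) = (\<psi> u, a u ** Z)\<close>;
  the class of its jet at \<open>x\<close> has the coordinates \<open>(x, \<psi> x, D\<psi>(x), a x, (\<partial>\<^sub>k a(x))\<^sub>k)\<close>, read off
  from the representative whose source is the frame \<open>(x, mat 1)\<close>. It maps \<open>Jt M\<close> (\<open>M\<close> open) onto
  the open set of all \<open>(x, y, F, A, B)\<close> with \<open>x, y \<in> M\<close> and \<open>F, A\<close> invertible.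
\<close>

type_synonym jcoord = "point \<times> point \<times> (real^3^3) \<times> (real^3^3) \<times> (real^3^3^3)"

definition jt_coords :: "reduced_jet \<Rightarrow> jcoord" where
  "jt_coords c = (THE p. \<exists>x y A L. ((x, mat 1), (y, A), L) \<in> c \<and>
     p = (x, y, matrix (\<lambda>u. fst (L (u, 0))), A, (\<chi> k. snd (L (axis k 1, 0)))))"

definition jt_of :: "jcoord \<Rightarrow> reduced_jet" where
  "jt_of p = inv_into (Jt UNIV) jt_coords p"


section \<open>Lie subgroupoids\<close>

definition embedded_submanifold :: "nat \<Rightarrow> 'a::euclidean_space set \<Rightarrow> bool" where
  "embedded_submanifold k S \<longleftrightarrow>
     (\<forall>p\<in>S. \<exists>V V' (h :: 'a \<Rightarrow> 'a) L. p \<in> V \<and> diffeo_on V V' h \<and>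
        subspace L \<and> dim L = k \<and> h ` (S \<inter> V) = V' \<inter> L)"

text \<open>
  The manifold structure of an immersed submanifold is determined by its topology, which may be
  finer than the subspace topology. It is Hausdorff because it refines the subspace topology.
  A map into it is smooth iff it is continuous for its topology and smooth into the ambient space.
\<close>

definition immersed_submanifold :: "nat \<Rightarrow> 'a::euclidean_space topology \<Rightarrow> bool" where
  "immersed_submanifold k T \<longleftrightarrow>
     second_countable T \<and>
     (\<forall>p\<in>topspace T. \<exists>N. openin T N \<and> p \<in> N \<and>
        subtopology T N = top_of_set N \<and> embedded_submanifold k N)"

definition tangent_space :: "'a::euclidean_space topology \<Rightarrow> 'a \<Rightarrow> 'a set" where
  "tangent_space T p =
     {vector_derivative \<gamma> (at 0) | \<gamma> e. 0 < e \<and> smooth_on {-e<..<e::real} \<gamma> \<and>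
        continuous_map (top_of_set {-e<..<e}) T \<gamma> \<and> \<gamma> 0 = p}"

text \<open>
  A (possibly only immersed) Lie subgroupoid of \<open>Jt M\<close> with base \<open>N\<close>. The structure maps are
  restrictions of smooth maps of the ambient groupoid, so continuity for the topologies
  of \<open>T\<close> and \<open>T0\<close> is what their smoothness amounts to. In the coordinates, source and target are the
  projections to the first and second component.
\<close>

definition lie_subgroupoid :: "point set \<Rightarrow> point set \<Rightarrow> reduced_jet set \<Rightarrow> bool" where
  "lie_subgroupoid M N \<Omega> \<longleftrightarrow>
     N \<subseteq> M \<and> \<Omega> \<subseteq> Jt M \<and>
     (\<forall>c\<in>\<Omega>. src c \<in> N \<and> tgt c \<in> N) \<and>
     (\<forall>x\<in>N. jid x \<in> \<Omega>) \<and>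
     (\<forall>c\<in>\<Omega>. \<forall>d\<in>\<Omega>. src d = tgt c \<longrightarrow> d \<odot> c \<in> \<Omega>) \<and>
     (\<forall>c\<in>\<Omega>. jinv c \<in> \<Omega>) \<and>
     (\<exists>T T0 k m.
        topspace T = jt_coords ` \<Omega> \<and> immersed_submanifold k T \<and>
        topspace T0 = N \<and> immersed_submanifold m T0 \<and>
        continuous_map T T0 (\<lambda>p. fst p) \<and>
        continuous_map T T0 (\<lambda>p. fst (snd p)) \<and>
        continuous_map T0 T (\<lambda>x. jt_coords (jid x)) \<and>
        continuous_map T T (\<lambda>p. jt_coords (jinv (jt_of p))) \<and>
        continuous_map (subtopology (prod_topology T T) {(q, p). fst q = fst (snd p)}) T
          (\<lambda>(q, p). jt_coords (jt_of q \<odot> jt_of p)) \<and>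
        (\<forall>p\<in>topspace T.
           (\<lambda>v. fst v) ` tangent_space T p = tangent_space T0 (fst p) \<and>
           (\<lambda>v. fst (snd v)) ` tangent_space T p = tangent_space T0 (fst (snd p))))"

definition transitive_on :: "point set \<Rightarrow> reduced_jet set \<Rightarrow> bool" where
  "transitive_on M \<Omega> \<longleftrightarrow> (\<forall>x\<in>M. \<forall>y\<in>M. \<exists>c\<in>\<Omega>. src c = x \<and> tgt c = y)"

definition reduced_lie_subgroupoid :: "point set \<Rightarrow> reduced_jet set \<Rightarrow> bool" where
  "reduced_lie_subgroupoid M \<Omega> \<longleftrightarrow> lie_subgroupoid M M \<Omega> \<and> transitive_on M \<Omega>"


section \<open>Cosserat media\<close>

abbreviation deformation :: "point set \<Rightarrow> (frame \<Rightarrow> frame) \<Rightarrow> bool" where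
  "deformation U \<kappa> \<equiv> pb_embedding U \<kappa>"

definition mechanical_response :: "point set \<Rightarrow> (reduced_jet \<Rightarrow> 'v::real_normed_vector) \<Rightarrow> bool" where
  "mechanical_response B W \<longleftrightarrow>
     smooth_on (jt_coords ` Jt B) (\<lambda>p. W (jt_of p)) \<and>
     (\<forall>U V \<Psi>. local_pb_iso U V \<Psi> \<and> U \<subseteq> B \<and> V \<subseteq> B \<longrightarrow>
        (\<forall>x\<in>U. \<forall>z\<in>B.
           W (rjet x \<Psi>) = W (rjet x (Fmap (transl (z - base_map \<Psi> x)) \<circ> \<Psi>))))"

text \<open>
  Extension of \<open>W\<close> to the elements of \<open>Jt UNIV\<close> with source in \<open>B\<close>: translate the target back into
  \<open>B\<close>. By translation invariance the chosen point of \<open>B\<close>, here the source, does not matter.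
\<close>

definition response_ext :: "(reduced_jet \<Rightarrow> 'v) \<Rightarrow> reduced_jet \<Rightarrow> 'v" where
  "response_ext W c = W (rjet (tgt c) (Fmap (transl (src c - tgt c))) \<odot> c)"

definition material_groupoid :: "point set \<Rightarrow> (reduced_jet \<Rightarrow> 'v) \<Rightarrow> reduced_jet set" where
  "material_groupoid B W =
     {c \<in> Jt B. \<forall>\<kappa>. deformation B \<kappa> \<longrightarrow>
        response_ext W (rjet (tgt c) \<kappa> \<odot> c) = response_ext W (rjet (tgt c) \<kappa>)}"

definition homogeneous_set :: "point set \<Rightarrow> (reduced_jet \<Rightarrow> 'v) \<Rightarrow> point set \<Rightarrow> bool" where
  "homogeneous_set B W U \<longleftrightarrow>
     (\<exists>\<kappa>. deformation U \<kappa> \<and>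
        (\<forall>x\<in>U. \<forall>y\<in>U.
           rjet x (inv_into (FB U) \<kappa> \<circ> Fmap (transl (base_map \<kappa> y - base_map \<kappa> x)) \<circ> \<kappa>)
             \<in> material_groupoid B W))"

definition homogeneous :: "point set \<Rightarrow> (reduced_jet \<Rightarrow> 'v) \<Rightarrow> bool" where
  "homogeneous B W \<longleftrightarrow> homogeneous_set B W B"

definition locally_homogeneous :: "point set \<Rightarrow> (reduced_jet \<Rightarrow> 'v) \<Rightarrow> bool" where
  "locally_homogeneous B W \<longleftrightarrow>
     (\<forall>x\<in>B. \<exists>U. open U \<and> U \<subseteq> B \<and> x \<in> U \<and> homogeneous_set B W U)"


section \<open>Second-order non-holonomic prolongations\<close>

definition pi1_section :: "point set \<Rightarrow> (point \<times> point \<Rightarrow> pjet) \<Rightarrow> bool" where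
  "pi1_section U P \<longleftrightarrow>
     smooth_on (U \<times> U) P \<and>
     (\<forall>x\<in>U. \<forall>y\<in>U. P (x, y) \<in> Pi1 U \<and> fst (P (x, y)) = x \<and> fst (snd (P (x, y))) = y)"

definition integrable_section :: "point set \<Rightarrow> (point \<times> point \<Rightarrow> pjet) \<Rightarrow> bool" where
  "integrable_section U Q \<longleftrightarrow>
     (\<forall>x0\<in>U. \<forall>y0\<in>U. \<exists>D1 D2 \<psi>1 \<psi>2.
        x0 \<in> D1 \<and> D1 \<subseteq> U \<and> diffeo_on D1 (\<psi>1 ` D1) \<psi>1 \<and>
        y0 \<in> D2 \<and> D2 \<subseteq> U \<and> diffeo_on D2 (\<psi>2 ` D2) \<psi>2 \<and>
        (\<forall>x\<in>D1. \<forall>y\<in>D2.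
           Q (x, y) = j1 x (inv_into D2 \<psi>2 \<circ> transl (\<psi>2 y - \<psi>1 x) \<circ> \<psi>1)))"

text \<open>The map \<open>\<psi>\<^bsub>xy\<^esub>\<close> with \<open>Q (x, y) = j\<^sup>1\<^bsub>x,y\<^esub>\<psi>\<^bsub>xy\<^esub>\<close>; the prolongation depends on its 1-jet only.\<close>

definition section_rep ::
  "point set \<Rightarrow> (point \<times> point \<Rightarrow> pjet) \<Rightarrow> point \<times> point \<Rightarrow> point \<Rightarrow> point" where
  "section_rep U Q xy = (SOME \<psi>. represents U \<psi> (Q xy))"

definition section_bar :: "(point \<times> point \<Rightarrow> pjet) \<Rightarrow> (point \<Rightarrow> point) \<Rightarrow> frame \<Rightarrow> frame" where
  "section_bar P \<psi> z = pjet_act (P (fst z, \<psi> (fst z))) z"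

definition prolongation ::
  "point set \<Rightarrow> (point \<times> point \<Rightarrow> pjet) \<Rightarrow> (point \<times> point \<Rightarrow> pjet) \<Rightarrow> point \<times> point \<Rightarrow> reduced_jet" where
  "prolongation U P Q xy = rjet (fst xy) (section_bar P (section_rep U Q xy))"

definition integrable_prolongation_in ::
  "point set \<Rightarrow> reduced_jet set \<Rightarrow> (point \<times> point \<Rightarrow> pjet) \<Rightarrow> (point \<times> point \<Rightarrow> pjet) \<Rightarrow> bool" where
  "integrable_prolongation_in U \<Omega> P Q \<longleftrightarrow>
     pi1_section U P \<and> pi1_section U Q \<and> integrable_section U Q \<and>
     (\<forall>x\<in>U. \<forall>y\<in>U. prolongation U P Q (x, y) \<in> \<Omega>)"

definition integrable_prolongation :: "point set \<Rightarrow> reduced_jet set \<Rightarrow> bool" where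
  "integrable_prolongation M \<Omega> \<longleftrightarrow>
     reduced_lie_subgroupoid M \<Omega> \<and>
     (\<forall>x\<in>M. \<exists>U. open U \<and> U \<subseteq> M \<and> x \<in> U \<and> (\<exists>P Q. integrable_prolongation_in U \<Omega> P Q))"

text \<open>
  To deduce local homogeneity, an arbitrary smooth section \<open>P\<close> is not enough. Take
  \<open>t (x) = (-x\<^sub>2, x\<^sub>1, 0)\<close> and \<open>p (x, y) = t (x - y) \<bullet> (x + y) / 2\<close>. With \<open>P (x, y) = exp (p (x, y)) I\<close>
  and \<open>Q\<close> the jets of translations, the prolongation lies in the reduced Lie subgroupoid with
  coordinates \<open>(x, y, I, \<lambda> I, \<lambda> (t x - t y) \<otimes> I)\<close>, \<open>\<lambda> \<noteq> 0\<close>. It is the material groupoid of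
  \<open>(x, y, F, A, B) \<mapsto> (F, A / root 3 (det A), (A\<^sup>-\<^sup>1 B\<^sub>k - t\<^sub>k (x) I)\<^sub>k)\<close>, but homogeneity of any
  nonempty open set would force the form \<open>t\<^sub>1 dx\<^sub>1 + t\<^sub>2 dx\<^sub>2\<close> to be closed there. Hence the
  variant in which \<open>P\<close> is a morphism from the pair groupoid.
\<close>

definition multiplicative_section :: "point set \<Rightarrow> (point \<times> point \<Rightarrow> pjet) \<Rightarrow> bool" where
  "multiplicative_section U P \<longleftrightarrow>
     (\<forall>x\<in>U. \<forall>y\<in>U. \<forall>z\<in>U. pi1_comp (P (y, z)) (P (x, y)) = P (x, z))"

definition multiplicative_integrable_prolongation :: "point set \<Rightarrow> reduced_jet set \<Rightarrow> bool" where
  "multiplicative_integrable_prolongation M \<Omega> \<longleftrightarrow>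
     reduced_lie_subgroupoid M \<Omega> \<and>
     (\<forall>x\<in>M. \<exists>U. open U \<and> U \<subseteq> M \<and> x \<in> U \<and>
        (\<exists>P Q. multiplicative_section U P \<and> integrable_prolongation_in U \<Omega> P Q))"

end

theory Submission
  imports Defs
begin

text \<open>
  Equivariance puts a deformation in the form \<open>\<kappa> (u, Z) = (k u, a u ** Z)\<close> with a chart \<open>k\<close> and an
  invertible matrix field \<open>a\<close>. The jets of \<open>\<kappa>\<^sup>-\<^sup>1 \<circ> F\<tau> \<circ> \<kappa>\<close> are then the prolongation by
  \<open>P (x, y) = a y\<^sup>-\<^sup>1 ** a x\<close> of the section \<open>Q\<close> integrated by \<open>k\<close>. Conversely, a multiplicative \<open>P\<close>
  splits as \<open>a y\<^sup>-\<^sup>1 ** a x\<close> with \<open>a x = P (x, x0)\<close>, and \<open>a\<close> together with a chart integrating \<open>Q\<close>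
  near \<open>x0\<close> is a deformation. Identities belong to the material groupoid, so its base is all of \<open>B\<close>.
\<close>

section \<open>Calculus of smooth maps\<close>

text \<open>For a fixed field \<open>a\<close> with inverse \<open>a'\<close>, the assignment of
  \<open>pair_jet a a' x y F\<close> to \<open>(x, y, F)\<close> respects composition and inversion:
  the derivative of \<open>a'\<close> is determined by that of \<open>a\<close>, so the
  contributions at an intermediate point cancel. Questions about second-order jets thereby become
  computations with the first-order parts \<open>F\<close>. A prolongation has this form once
  \<open>P\<close> splits, because the choice of \<psi>_xy enters only through its value and
  derivative at \<open>x\<close>. Multiplicativity is what provides the splitting; a general
  \<open>P\<close> depends jointly on both points and need not come from a field. The other obstacle
  is transitivity, which is part of being a reduced subgroupoid. A homogeneous set supplies arrows
  only between its own points, so local homogeneity alone says nothing about arrows between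
  different components of \<open>B\<close>. Hence the local statements assume connectedness or
  transitivity.\<close>

lemma Ck_on_cong:
  assumes "open S" "\<And>x. x \<in> S \<Longrightarrow> f x = g x" "Ck_on k S f"
  shows "Ck_on k S g"
  using assms(2,3)
proof (induction k arbitrary: f g)
  case 0
  then show ?case by (simp cong: continuous_on_cong)
next
  case (Suc k)
  have *: "(g has_derivative frechet_derivative f (at x)) (at x)" if "x \<in> S" for x
  proof (rule has_derivative_transform_within_open[OF _ assms(1) that Suc.prems(1)])
    show "(f has_derivative frechet_derivative f (at x)) (at x)"
      using Suc.prems(2) that by (intro iffD1[OF frechet_derivative_works]) simp
  qed
  then have "frechet_derivative g (at x) = frechet_derivative f (at x)" if "x \<in> S" for x
    using frechet_derivative_at that by metis
  then have "Ck_on k S (\<lambda>x. frechet_derivative g (at x) v)" for v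
    using Suc.prems(2) by (auto intro: Suc.IH[of "\<lambda>x. frechet_derivative f (at x) v"])
  with * show ?case
    unfolding Ck_on.simps differentiable_def by blast
qed

text \<open>Derivatives at a point are unique, so any explicit formula can stand in for
  \<open>frechet_derivative\<close>; the closure properties below gain one order from such a
  formula.\<close>

lemma Ck_on_SucI:
  assumes "open S" "\<And>x. x \<in> S \<Longrightarrow> (f has_derivative f' x) (at x)"
    and "\<And>v. Ck_on k S (\<lambda>x. f' x v)"
  shows "Ck_on (Suc k) S f"
proof -
  have "frechet_derivative f (at x) = f' x" if "x \<in> S" for x
    using frechet_derivative_at[OF assms(2)[OF that]] by simp
  then have "Ck_on k S (\<lambda>x. frechet_derivative f (at x) v)" for v
    by (intro Ck_on_cong[OF assms(1) _ assms(3)[of v]]) simp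
  then show ?thesis using assms(2) by (auto simp: differentiable_def)
qed

lemma Ck_on_SucD:
  assumes "Ck_on (Suc k) S f"
  shows "Ck_on k S f"
  using assms
proof (induction k arbitrary: f)
  case 0
  then show ?case
    unfolding Ck_on.simps
    by (meson continuous_on_eq_continuous_within differentiable_at_withinI
        differentiable_imp_continuous_within)
next
  case (Suc k)
  then show ?case by (metis Ck_on.simps(2))
qed

lemma Ck_on_Suc_has_derivative:
  "Ck_on (Suc k) S f \<Longrightarrow> x \<in> S \<Longrightarrow> (f has_derivative frechet_derivative f (at x)) (at x)"
  by (intro iffD1[OF frechet_derivative_works]) simp

lemma Ck_on_subset: "Ck_on k S f \<Longrightarrow> T \<subseteq> S \<Longrightarrow> Ck_on k T f"
  by (induction k arbitrary: f) (auto intro: continuous_on_subset)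

lemma Ck_on_const: "open S \<Longrightarrow> Ck_on k S (\<lambda>x. c)"
  by (induction k arbitrary: c) (auto intro: continuous_on_const)

lemma Ck_on_bounded_linear_compose:
  assumes "open S" "bounded_linear L" "Ck_on k S f"
  shows "Ck_on k S (\<lambda>x. L (f x))"
  using assms(3)
proof (induction k arbitrary: f)
  case 0
  then show ?case
    using bounded_linear.continuous_on[OF assms(2)] by simp
next
  case (Suc k)
  show ?case
  proof (rule Ck_on_SucI[OF assms(1)])
    fix x assume "x \<in> S"
    then show "((\<lambda>x. L (f x)) has_derivative (\<lambda>v. L (frechet_derivative f (at x) v))) (at x)"
      by (intro bounded_linear.has_derivative[OF assms(2)] Ck_on_Suc_has_derivative[OF Suc.prems])
  next
    fix v
    show "Ck_on k S (\<lambda>x. L (frechet_derivative f (at x) v))"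
      using Suc by simp
  qed
qed

lemma Ck_on_add:
  assumes "open S" "Ck_on k S f" "Ck_on k S g"
  shows "Ck_on k S (\<lambda>x. f x + g x)"
  using assms(2,3)
proof (induction k arbitrary: f g)
  case 0
  then show ?case by (simp add: continuous_on_add)
next
  case (Suc k)
  show ?case
  proof (rule Ck_on_SucI[OF assms(1)])
    fix x assume "x \<in> S"
    then show "((\<lambda>x. f x + g x) has_derivative
        (\<lambda>v. frechet_derivative f (at x) v + frechet_derivative g (at x) v)) (at x)"
      using Suc.prems by (intro has_derivative_add Ck_on_Suc_has_derivative)
  next
    fix v
    show "Ck_on k S (\<lambda>x. frechet_derivative f (at x) v + frechet_derivative g (at x) v)"
      using Suc by simp
  qed
qed

lemma Ck_on_sum:
  assumes "open S" "\<And>i. i \<in> I \<Longrightarrow> Ck_on k S (f i)"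
  shows "Ck_on k S (\<lambda>x. \<Sum>i\<in>I. f i x)"
  using assms(2)
  by (induction I rule: infinite_finite_induct)
     (simp_all add: assms(1) Ck_on_const Ck_on_add del: Ck_on.simps)

lemma Ck_on_bounded_bilinear:
  assumes "open S" "bounded_bilinear h" "Ck_on k S f" "Ck_on k S g"
  shows "Ck_on k S (\<lambda>x. h (f x) (g x))"
  using assms(3,4)
proof (induction k arbitrary: f g)
  case 0
  then show ?case by (simp add: bounded_bilinear.continuous_on[OF assms(2)])
next
  case (Suc k)
  show ?case
  proof (rule Ck_on_SucI[OF assms(1)])
    fix x assume "x \<in> S"
    then show "((\<lambda>x. h (f x) (g x)) has_derivative
        (\<lambda>v. h (f x) (frechet_derivative g (at x) v) + h (frechet_derivative f (at x) v) (g x))) (at x)"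
      using Suc.prems by (intro bounded_bilinear.FDERIV[OF assms(2)] Ck_on_Suc_has_derivative)
  next
    fix v
    show "Ck_on k S (\<lambda>x. h (f x) (frechet_derivative g (at x) v)
        + h (frechet_derivative f (at x) v) (g x))"
      using Suc.prems by (intro Ck_on_add[OF assms(1)] Suc.IH Ck_on_SucD[OF Suc.prems(1)]
          Ck_on_SucD[OF Suc.prems(2)]) simp_all
  qed
qed

text \<open>The chain rule evaluates the derivative of \<open>g\<close> in the moving direction
  \<open>frechet_derivative f (at x) v\<close>, whereas \<open>Ck_on\<close> controls fixed
  directions only. Expanding that direction in \<open>Basis\<close> leaves scalar coefficients
  coming from \<open>f\<close>, multiplied by fixed directional derivatives of \<open>g\<close>
  along \<open>f\<close>, to which the induction applies.\<close>

lemma Ck_on_compose: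
  fixes f :: "'a::euclidean_space \<Rightarrow> 'b::euclidean_space" and g :: "'b \<Rightarrow> 'c::real_normed_vector"
  assumes "open S" "open T" "f ` S \<subseteq> T" "Ck_on k S f" "Ck_on k T g"
  shows "Ck_on k S (\<lambda>x. g (f x))"
  using assms(4,5)
proof (induction k arbitrary: g)
  case 0
  then show ?case
    using assms(3) by (auto intro: continuous_on_compose2)
next
  case (Suc k)
  let ?f' = "\<lambda>x. frechet_derivative f (at x)" and ?g' = "\<lambda>y. frechet_derivative g (at y)"
  have g': "(g has_derivative ?g' (f x)) (at (f x))" if "x \<in> S" for x
    using Suc.prems(2) that assms(3) by (intro Ck_on_Suc_has_derivative) auto
  show ?case
  proof (rule Ck_on_SucI[OF assms(1)])
    fix x assume x: "x \<in> S"
    have "((\<lambda>x. g (f x)) has_derivative (\<lambda>v. ?g' (f x) (?f' x v))) (at x)"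
      using has_derivative_compose[OF Ck_on_Suc_has_derivative[OF Suc.prems(1) x] g'[OF x]] .
    moreover have *: "?g' (f x) w = (\<Sum>i\<in>Basis. (w \<bullet> i) *\<^sub>R ?g' (f x) i)" for w
    proof -
      have "linear (?g' (f x))" using g'[OF x] has_derivative_linear by blast
      then have "?g' (f x) (\<Sum>i\<in>Basis. (w \<bullet> i) *\<^sub>R i) = (\<Sum>i\<in>Basis. (w \<bullet> i) *\<^sub>R ?g' (f x) i)"
        by (simp only: linear_sum linear_scale)
      then show ?thesis by (simp only: euclidean_representation)
    qed
    ultimately show "((\<lambda>x. g (f x)) has_derivative
        (\<lambda>v. \<Sum>i\<in>Basis. (?f' x v \<bullet> i) *\<^sub>R ?g' (f x) i)) (at x)"
      by (subst *[symmetric])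
  next
    fix v
    have "Ck_on k S (\<lambda>x. ?f' x v \<bullet> i)" for i
      using Suc.prems(1) by (intro Ck_on_bounded_linear_compose[OF assms(1) bounded_linear_inner_left]) simp
    moreover have "Ck_on k S (\<lambda>x. ?g' (f x) i)" for i
      using Suc.prems by (intro Suc.IH[OF Ck_on_SucD[OF Suc.prems(1)]]) simp
    ultimately show "Ck_on k S (\<lambda>x. \<Sum>i\<in>Basis. (?f' x v \<bullet> i) *\<^sub>R ?g' (f x) i)"
      by (intro Ck_on_sum[OF assms(1)] Ck_on_bounded_bilinear[OF assms(1) bounded_bilinear_scaleR])
  qed
qed

lemma smooth_on_cong:
  "open S \<Longrightarrow> (\<And>x. x \<in> S \<Longrightarrow> f x = g x) \<Longrightarrow> smooth_on S f \<Longrightarrow> smooth_on S g"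
  unfolding smooth_on_def by (blast intro: Ck_on_cong)

lemma smooth_on_subset: "smooth_on S f \<Longrightarrow> T \<subseteq> S \<Longrightarrow> smooth_on T f"
  unfolding smooth_on_def by (blast intro: Ck_on_subset)

lemma smooth_on_const: "open S \<Longrightarrow> smooth_on S (\<lambda>x. c)"
  unfolding smooth_on_def by (blast intro: Ck_on_const)

lemma smooth_on_bounded_linear_compose:
  "open S \<Longrightarrow> bounded_linear L \<Longrightarrow> smooth_on S f \<Longrightarrow> smooth_on S (\<lambda>x. L (f x))"
  unfolding smooth_on_def by (blast intro: Ck_on_bounded_linear_compose)

lemma smooth_on_add:
  "open S \<Longrightarrow> smooth_on S f \<Longrightarrow> smooth_on S g \<Longrightarrow> smooth_on S (\<lambda>x. f x + g x)"
  unfolding smooth_on_def by (blast intro: Ck_on_add)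

lemma smooth_on_sum:
  "open S \<Longrightarrow> (\<And>i. i \<in> I \<Longrightarrow> smooth_on S (f i)) \<Longrightarrow> smooth_on S (\<lambda>x. \<Sum>i\<in>I. f i x)"
  unfolding smooth_on_def by (blast intro: Ck_on_sum)

lemma smooth_on_bounded_bilinear:
  "open S \<Longrightarrow> bounded_bilinear h \<Longrightarrow> smooth_on S f \<Longrightarrow> smooth_on S g \<Longrightarrow>
    smooth_on S (\<lambda>x. h (f x) (g x))"
  unfolding smooth_on_def by (blast intro: Ck_on_bounded_bilinear)

lemma smooth_on_compose:
  fixes f :: "'a::euclidean_space \<Rightarrow> 'b::euclidean_space" and g :: "'b \<Rightarrow> 'c::real_normed_vector"
  shows "open S \<Longrightarrow> open T \<Longrightarrow> f ` S \<subseteq> T \<Longrightarrow> smooth_on S f \<Longrightarrow> smooth_on T g \<Longrightarrow>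
    smooth_on S (\<lambda>x. g (f x))"
  unfolding smooth_on_def by (blast intro: Ck_on_compose)

lemma smooth_on_has_derivative:
  "smooth_on S f \<Longrightarrow> x \<in> S \<Longrightarrow> (f has_derivative frechet_derivative f (at x)) (at x)"
  unfolding smooth_on_def by (metis Ck_on_Suc_has_derivative)

lemma smooth_on_frechet_derivative:
  "smooth_on S f \<Longrightarrow> smooth_on S (\<lambda>x. frechet_derivative f (at x) v)"
  unfolding smooth_on_def by (metis Ck_on.simps(2))

lemma smooth_on_imp_continuous_on: "smooth_on S f \<Longrightarrow> continuous_on S f"
  unfolding smooth_on_def by (metis Ck_on.simps(1))

lemma smooth_on_bounded_linear:
  assumes "open S" "bounded_linear L"
  shows "smooth_on S L"
proof -
  have "Ck_on k S L" for k
  proof (cases k)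
    case 0
    then show ?thesis
      by (simp add: assms(2) linear_continuous_on)
  next
    case (Suc n)
    then show ?thesis
      using Ck_on_SucI[OF assms(1) bounded_linear_imp_has_derivative[OF assms(2)]]
      by (simp add: Ck_on_const[OF assms(1)] del: Ck_on.simps)
  qed
  then show ?thesis by (simp add: smooth_on_def)
qed

lemma smooth_on_Pair:
  assumes "open S" "smooth_on S f" "smooth_on S g"
  shows "smooth_on S (\<lambda>x. (f x, g x))"
proof -
  have "smooth_on S (\<lambda>x. (f x, 0) + (0, g x))"
    using assms
    by (intro smooth_on_add smooth_on_bounded_linear_compose[where L = "\<lambda>y. (y, 0)"]
        smooth_on_bounded_linear_compose[where L = "\<lambda>y. (0, y)"])
       (auto intro!: bounded_linear_Pair bounded_linear_ident bounded_linear_zero)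
  then show ?thesis by simp
qed

lemma smooth_on_fst: "open S \<Longrightarrow> smooth_on S f \<Longrightarrow> smooth_on S (\<lambda>x. fst (f x))"
  by (rule smooth_on_bounded_linear_compose[OF _ bounded_linear_fst])

lemma smooth_on_snd: "open S \<Longrightarrow> smooth_on S f \<Longrightarrow> smooth_on S (\<lambda>x. snd (f x))"
  by (rule smooth_on_bounded_linear_compose[OF _ bounded_linear_snd])

lemma smooth_on_ident: "open S \<Longrightarrow> smooth_on S (\<lambda>x. x)"
  by (rule smooth_on_bounded_linear[OF _ bounded_linear_ident])

section \<open>Matrix multiplication and inversion\<close>

lemma bounded_bilinear_matrix_mult:
  "bounded_bilinear ((**) :: real^'n^'m \<Rightarrow> real^'p^'n \<Rightarrow> real^'p^'m)"
  unfolding bilinear_conv_bounded_bilinear[symmetric] bilinear_def linear_iff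
  by (simp add: vec_eq_iff matrix_matrix_mult_def sum.distrib sum_distrib_left algebra_simps)

lemmas matrix_mult_distribs =
  bounded_bilinear.add_left[OF bounded_bilinear_matrix_mult]
  bounded_bilinear.add_right[OF bounded_bilinear_matrix_mult]
  bounded_bilinear.diff_left[OF bounded_bilinear_matrix_mult]
  bounded_bilinear.diff_right[OF bounded_bilinear_matrix_mult]
  bounded_bilinear.minus_left[OF bounded_bilinear_matrix_mult]
  bounded_bilinear.minus_right[OF bounded_bilinear_matrix_mult]

lemma open_invertible: "open {A :: real^'n^'n. invertible A}"
proof -
  have "open {A :: real^'n^'n. det A \<noteq> 0}"
    unfolding det_def by (intro open_Collect_neq continuous_intros)
  then show ?thesis by (simp add: invertible_det_nz)
qed

lemma invertible_mat_1: "invertible (mat 1 :: real^'n^'n)"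
  unfolding invertible_def by (metis matrix_mul_lid)

lemma matrix_inv_right_real: "invertible (A :: real^'n^'n) \<Longrightarrow> A ** matrix_inv A = mat 1"
  and matrix_inv_left_real: "invertible (A :: real^'n^'n) \<Longrightarrow> matrix_inv A ** A = mat 1"
  unfolding invertible_def matrix_inv_def by (metis (mono_tags, lifting) someI_ex)+

text \<open>
  Differentiability of inversion comes from the inverse function theorem applied to
  \<open>(Z, Y) \<mapsto> (Z, Z ** Y)\<close>, whose inverse is \<open>(Z, X) \<mapsto> (Z, matrix_inv Z ** X)\<close>.
\<close>

lemma has_derivative_matrix_inv:
  fixes A :: "real^'n^'n"
  assumes "invertible A"
  shows "(matrix_inv has_derivative (\<lambda>H. - (matrix_inv A ** H ** matrix_inv A))) (at A)"
proof -
  let ?I = "matrix_inv A"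
  define S where "S = {A :: real^'n^'n. invertible A} \<times> (UNIV :: (real^'n^'n) set)"
  define f where "f = (\<lambda>(Z, Y :: real^'n^'n). (Z, Z ** Y) :: (real^'n^'n) \<times> (real^'n^'n))"
  define f' where "f' = (\<lambda>(Z :: real^'n^'n, Y :: real^'n^'n) (H, K). (H, Z ** K + H ** Y) :: (real^'n^'n) \<times> (real^'n^'n))"
  define g where "g = (\<lambda>(Z, X :: real^'n^'n). (Z, matrix_inv Z ** X) :: (real^'n^'n) \<times> (real^'n^'n))"
  \<comment> \<open>For invertible \<open>Z\<close>, \<open>g' (Z, Y)\<close> inverts
    \<open>f' (Z, Y)\<close>: the equation \<open>Z ** K' + H ** Y = K\<close> is solved for
    \<open>K'\<close>.\<close>
  define g' where "g' = (\<lambda>(Z :: real^'n^'n, Y :: real^'n^'n) (H, K :: real^'n^'n). (H, matrix_inv Z ** (K - H ** Y)) :: (real^'n^'n) \<times> (real^'n^'n))"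
  have I: "A ** ?I = mat 1" "?I ** A = mat 1"
    using assms by (simp_all add: matrix_inv_left_real matrix_inv_right_real)
  have "(g has_derivative g' (A, ?I)) (at (f (A, ?I)))"
  proof (rule has_derivative_inverse_on[where S = S and f' = f' and g' = g' and x = "(A, ?I)"])
    show "open S" by (simp add: S_def open_Times open_invertible)
    show "(A, ?I) \<in> S" using assms by (simp add: S_def)
    show "f' (A, ?I) \<circ> g' (A, ?I) = id"
      by (auto simp: f'_def g'_def matrix_mul_assoc I)
    show "(f has_derivative f' x) (at x)" if "x \<in> S" for x
    proof -
      have "((\<lambda>z. (fst z, fst z ** snd z)) has_derivative
          (\<lambda>h. (fst h, fst x ** snd h + fst h ** snd x))) (at x)"
        by (intro has_derivative_Pair bounded_bilinear.FDERIV[OF bounded_bilinear_matrix_mult]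
            bounded_linear_imp_has_derivative bounded_linear_fst bounded_linear_snd)
      then show ?thesis by (simp add: f_def f'_def case_prod_unfold)
    qed
    show "g (f x) = x" if "x \<in> S" for x
      using that by (auto simp: S_def f_def g_def matrix_mul_assoc matrix_inv_left_real)
  qed
  then have "(g has_derivative g' (A, ?I)) (at (A, mat 1))"
    by (simp add: f_def I)
  \<comment> \<open>On the slice with second component \<open>mat 1\<close> the map \<open>g\<close>
    returns \<open>matrix_inv Z\<close>, and the direction \<open>(H, 0)\<close> yields the stated
    derivative.\<close>
  moreover have "((\<lambda>Z. (Z, mat 1)) has_derivative (\<lambda>H. (H, 0))) (at A)"
    by (intro derivative_intros)
  ultimately have "((\<lambda>Z. g (Z, mat 1)) has_derivative (\<lambda>H. g' (A, ?I) (H, 0))) (at A)"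
    by (rule has_derivative_compose[rotated])
  then have "((\<lambda>Z. snd (g (Z, mat 1))) has_derivative (\<lambda>H. snd (g' (A, ?I) (H, 0)))) (at A)"
    by (rule has_derivative_snd)
  then show ?thesis by (simp add: g_def g'_def matrix_mult_distribs matrix_mul_assoc)
qed

lemma smooth_on_matrix_mult:
  fixes f :: "'a::euclidean_space \<Rightarrow> real^'n^'m" and g :: "'a \<Rightarrow> real^'p^'n"
  shows "open S \<Longrightarrow> smooth_on S f \<Longrightarrow> smooth_on S g \<Longrightarrow> smooth_on S (\<lambda>x. f x ** g x)"
  by (rule smooth_on_bounded_bilinear[OF _ bounded_bilinear_matrix_mult])

text \<open>The derivative of inversion is a polynomial expression in inversion itself, so each
  order of smoothness yields the next, starting from continuity.\<close>

lemma smooth_on_matrix_inv: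
  "smooth_on {A :: real^'n^'n. invertible A} matrix_inv"
proof -
  let ?S = "{A :: real^'n^'n. invertible A}"
  have "Ck_on k ?S matrix_inv" for k
  proof (induction k)
    case 0
    have "(matrix_inv has_derivative (\<lambda>H. - (matrix_inv A ** H ** matrix_inv A))) (at A within ?S)"
      if "A \<in> ?S" for A
      using that has_derivative_matrix_inv has_derivative_at_withinI by blast
    then show ?case
      unfolding Ck_on.simps by (rule has_derivative_continuous_on)
  next
    case (Suc k)
    show ?case
    proof (rule Ck_on_SucI[OF open_invertible])
      fix A :: "real^'n^'n" assume "A \<in> ?S"
      then show "(matrix_inv has_derivative (\<lambda>H. - (matrix_inv A ** H ** matrix_inv A))) (at A)"
        by (intro has_derivative_matrix_inv) simp
    next
      fix H :: "real^'n^'n"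
      show "Ck_on k ?S (\<lambda>A. - (matrix_inv A ** H ** matrix_inv A))"
        by (intro Ck_on_bounded_linear_compose[OF open_invertible bounded_linear_minus[OF bounded_linear_ident]]
            Ck_on_bounded_bilinear[OF open_invertible bounded_bilinear_matrix_mult]
            Ck_on_const[OF open_invertible] Suc.IH)
    qed
  qed
  then show ?thesis by (simp add: smooth_on_def)
qed

lemma smooth_on_matrix_frechet_derivative:
  fixes f :: "real^'n \<Rightarrow> real^'m"
  assumes "open S" "smooth_on S f"
  shows "smooth_on S (\<lambda>x. matrix (frechet_derivative f (at x)))"
proof -
  \<comment> \<open>\<open>E j v\<close> is the matrix with column \<open>j\<close> equal to
    \<open>v\<close> and zeros elsewhere; the Jacobian is then a sum of linear images of directional
    derivatives.\<close>
  define E where "E j v = (\<chi> i k. if k = j then v $ i else 0)" for j :: 'n and v :: "real^'m"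
  have "bounded_linear (E j)" for j
    unfolding linear_conv_bounded_linear[symmetric] linear_iff E_def
    by (simp add: vec_eq_iff)
  then have "smooth_on S (\<lambda>x. \<Sum>j\<in>UNIV. E j (frechet_derivative f (at x) (axis j 1)))"
    using assms
    by (intro smooth_on_sum smooth_on_bounded_linear_compose[where L = "E _"] smooth_on_frechet_derivative)
  moreover have "(\<Sum>j\<in>UNIV. E j (frechet_derivative f (at x) (axis j 1)))
      = matrix (frechet_derivative f (at x))" for x
    by (simp add: E_def matrix_def vec_eq_iff)
  ultimately show ?thesis by simp
qed

text \<open>First-order jets store Jacobian matrices while reduced jets store linear maps; this
  passes from one to the other.\<close>

lemma matrix_vector_mul_frechet_derivative:
  fixes f :: "real^'n \<Rightarrow> real^'m"
  assumes "(f has_derivative f') (at x)"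
  shows "(*v) (matrix f') = f'"
  using matrix_works[OF has_derivative_linear[OF assms, unfolded linear_matrix_vector_mul_eq[symmetric]]]
  by (simp add: fun_eq_iff)

section \<open>Diffeomorphisms and their derivatives\<close>

text \<open>Invariance of domain makes the image open. The derivative of the inverse is
  \<open>matrix_inv (?M (?g y))\<close>, which contains the inverse \<open>?g\<close> only inside a
  smooth map, so smoothness is gained order by order.\<close>

lemma smooth_inverse:
  fixes f :: "real^'n \<Rightarrow> real^'n"
  assumes "open S" "smooth_on S f" "inj_on f S"
    and inv: "\<And>x. x \<in> S \<Longrightarrow> invertible (matrix (frechet_derivative f (at x)))"
  shows "diffeo_on S (f ` S) f"
proof -
  let ?g = "inv_into S f"
  let ?M = "\<lambda>x. matrix (frechet_derivative f (at x))"
  have open_im: "open (f ` S)"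
    using assms by (intro invariance_of_domain smooth_on_imp_continuous_on)
  have der: "(?g has_derivative (\<lambda>v. matrix_inv (?M (?g y)) *v v)) (at y)" if "y \<in> f ` S" for y
  proof -
    obtain x where x: "x \<in> S" "y = f x" using \<open>y \<in> f ` S\<close> by blast
    have f': "(f has_derivative frechet_derivative f (at z)) (at z)" if "z \<in> S" for z
      using smooth_on_has_derivative[OF assms(2) that] .
    have "(?g has_derivative (\<lambda>v. matrix_inv (?M x) *v v)) (at (f x))"
    proof (rule has_derivative_inverse_on[OF assms(1) f' _ _ x(1)])
      show "?g (f z) = z" if "z \<in> S" for z
        using that assms(3) by simp
      have "frechet_derivative f (at x) (matrix_inv (?M x) *v v) = v" for v
      proof -
        have "?M x *v (matrix_inv (?M x) *v v) = v"
          by (simp add: matrix_vector_mul_assoc matrix_inv_right_real[OF inv[OF x(1)]])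
        then show ?thesis
          by (simp add: matrix_vector_mul_frechet_derivative[OF f'[OF x(1)]])
      qed
      then show "frechet_derivative f (at x) \<circ> (\<lambda>v. matrix_inv (?M x) *v v) = id"
        by auto
    qed
    then show ?thesis using x assms(3) by simp
  qed
  have "Ck_on k (f ` S) ?g" for k
  proof (induction k)
    case 0
    show ?case
      unfolding Ck_on.simps
      by (rule has_derivative_continuous_on[OF has_derivative_at_withinI[OF der]])
  next
    case (Suc k)
    show ?case
    proof (rule Ck_on_SucI[OF open_im der])
      fix v
      have M: "Ck_on k S (\<lambda>x. matrix_inv (?M x))"
        by (rule Ck_on_compose[OF assms(1) open_invertible])
           (use inv smooth_on_matrix_frechet_derivative[OF assms(1,2)] smooth_on_matrix_inv
             in \<open>auto simp: smooth_on_def\<close>)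
      have "Ck_on k (f ` S) (\<lambda>y. matrix_inv (?M (?g y)))"
        by (rule Ck_on_compose[OF open_im assms(1) _ Suc.IH M]) (auto intro: inv_into_into)
      then show "Ck_on k (f ` S) (\<lambda>y. matrix_inv (?M (?g y)) *v v)"
        by (intro Ck_on_bounded_linear_compose[OF open_im, where L = "\<lambda>A. A *v v"])
           (simp_all add: linear_conv_bounded_linear[symmetric] linear_iff
             matrix_vector_mult_add_rdistrib scaleR_matrix_vector_assoc)
    qed
  qed
  then show ?thesis
    using assms open_im by (simp add: diffeo_on_def smooth_on_def inj_on_imp_bij_betw)
qed

lemma diffeo_on_has_derivative:
  assumes "diffeo_on S T f" "x \<in> S"
  shows "(f has_derivative frechet_derivative f (at x)) (at x)"
    and "(inv_into S f has_derivative frechet_derivative (inv_into S f) (at (f x))) (at (f x))"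
  using assms smooth_on_has_derivative unfolding diffeo_on_def by (metis, metis bij_betwE)

lemma diffeo_on_derivative_inverse:
  assumes "diffeo_on S T f" "x \<in> S"
  shows "frechet_derivative (inv_into S f) (at (f x)) \<circ> frechet_derivative f (at x) = id"
    and "frechet_derivative f (at x) \<circ> frechet_derivative (inv_into S f) (at (f x)) = id"
proof -
  note d = diffeo_on_has_derivative[OF assms]
  have *: "open S" "open T" "inj_on f S" "f ` S = T"
    using assms unfolding diffeo_on_def bij_betw_def by auto
  have fx: "f x \<in> T" using * assms(2) by blast
  have "((\<lambda>u. inv_into S f (f u)) has_derivative
      (\<lambda>v. frechet_derivative (inv_into S f) (at (f x)) (frechet_derivative f (at x) v))) (at x)"
    using has_derivative_compose[OF d] .
  then have "((\<lambda>u. u) has_derivative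
      (\<lambda>v. frechet_derivative (inv_into S f) (at (f x)) (frechet_derivative f (at x) v))) (at x)"
    by (rule has_derivative_transform_within_open[OF _ *(1) assms(2)]) (simp add: *(3))
  from has_derivative_unique[OF this has_derivative_ident]
  show "frechet_derivative (inv_into S f) (at (f x)) \<circ> frechet_derivative f (at x) = id"
    by (simp add: fun_eq_iff)
  have "((\<lambda>u. f (inv_into S f u)) has_derivative
      (\<lambda>v. frechet_derivative f (at x) (frechet_derivative (inv_into S f) (at (f x)) v))) (at (f x))"
    using has_derivative_compose[OF d(2), of f "frechet_derivative f (at x)"] d(1) *(3) assms(2) by simp
  then have "((\<lambda>u. u) has_derivative
      (\<lambda>v. frechet_derivative f (at x) (frechet_derivative (inv_into S f) (at (f x)) v))) (at (f x))"
    by (rule has_derivative_transform_within_open[OF _ *(2) fx]) (simp add: *(4)[symmetric] f_inv_into_f)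
  from has_derivative_unique[OF this has_derivative_ident]
  show "frechet_derivative f (at x) \<circ> frechet_derivative (inv_into S f) (at (f x)) = id"
    by (simp add: fun_eq_iff)
qed

section \<open>Reduced jets in normal form\<close>

text \<open>
  \<open>tri_jet x y F A B\<close> is the reduced jet at \<open>x\<close> of \<open>(u, Z) \<mapsto> (\<psi> u, c u ** Z)\<close>, where
  \<open>\<psi> x = y\<close>, \<open>c x = A\<close>, and \<open>F\<close>, \<open>B\<close> are the derivatives of \<open>\<psi>\<close>, \<open>c\<close> at \<open>x\<close>.
\<close>

definition tri_jet ::
  "point \<Rightarrow> point \<Rightarrow> (point \<Rightarrow> point) \<Rightarrow> real^3^3 \<Rightarrow> (point \<Rightarrow> real^3^3) \<Rightarrow> reduced_jet" where
  "tri_jet x y F A B = {((x, g), (y, A ** g), \<lambda>h. (F (fst h), B (fst h) ** g + A ** snd h)) | g. invertible g}"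

lemma rjet_eq: "rjet x \<Psi> = {fjet (x, g) \<Psi> | g. invertible g}"
  by (simp add: rjet_def frame_act_def)

lemma open_FB: "open U \<Longrightarrow> open (FB U)"
  by (simp add: FB_def open_Times open_invertible)

lemma has_derivative_bundle_map:
  fixes \<Psi> :: "frame \<Rightarrow> frame"
  assumes "open N" "x \<in> N" "invertible g"
    and \<Psi>: "\<And>u Z. u \<in> N \<Longrightarrow> invertible Z \<Longrightarrow> \<Psi> (u, Z) = (\<psi> u, c u ** Z)"
    and "(\<psi> has_derivative F) (at x)" "(c has_derivative B) (at x)"
  shows "(\<Psi> has_derivative (\<lambda>h. (F (fst h), B (fst h) ** g + c x ** snd h))) (at (x, g))"
proof -
  have fst: "((\<lambda>z :: frame. f (fst z)) has_derivative (\<lambda>h. f' (fst h))) (at (x, g))"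
    if "(f has_derivative f') (at x)" for f :: "point \<Rightarrow> 'z::real_normed_vector" and f'
    using has_derivative_compose[OF bounded_linear_imp_has_derivative[OF bounded_linear_fst],
        of f f' "(x, g)" UNIV] that by simp
  have "((\<lambda>z. (\<psi> (fst z), c (fst z) ** snd z)) has_derivative
      (\<lambda>h. (F (fst h), c (fst (x, g)) ** snd h + B (fst h) ** snd (x, g)))) (at (x, g))"
    by (rule has_derivative_Pair[OF fst[OF assms(5)]
          bounded_bilinear.FDERIV[OF bounded_bilinear_matrix_mult fst[OF assms(6)]
            bounded_linear_imp_has_derivative[OF bounded_linear_snd]]])
  then have "((\<lambda>z. (\<psi> (fst z), c (fst z) ** snd z)) has_derivative
      (\<lambda>h. (F (fst h), B (fst h) ** g + c x ** snd h))) (at (x, g))"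
    by (simp only: fst_conv snd_conv add.commute[of "B _ ** g"])
  then show ?thesis
    by (rule has_derivative_transform_within_open[OF _ open_FB[OF assms(1)]])
       (use assms(2,3) \<Psi> in \<open>auto simp: FB_def\<close>)
qed

lemma rjet_eq_tri_jet:
  assumes "open N" "x \<in> N"
    and \<Psi>: "\<And>u Z. u \<in> N \<Longrightarrow> invertible Z \<Longrightarrow> \<Psi> (u, Z) = (\<psi> u, c u ** Z)"
    and "(\<psi> has_derivative F) (at x)" "(c has_derivative B) (at x)"
  shows "rjet x \<Psi> = tri_jet x (\<psi> x) F (c x) B"
proof -
  have "fjet (x, g) \<Psi> = ((x, g), (\<psi> x, c x ** g), \<lambda>h. (F (fst h), B (fst h) ** g + c x ** snd h))"
    if "invertible g" for g
    using frechet_derivative_at[OF has_derivative_bundle_map[OF assms(1,2) that \<Psi> assms(4,5)], symmetric]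
      \<Psi>[OF assms(2) that]
    by (simp add: fjet_def)
  then show ?thesis
    unfolding rjet_eq tri_jet_def by (intro Collect_cong ex_cong1) auto
qed

text \<open>Representatives match because the target frame \<open>A ** g\<close> is again
  invertible, hence the source of a representative of the second jet. The last entry is the product
  rule for a second matrix field along \<open>\<psi>\<close> times the first.\<close>

lemma tri_jet_comp:
  assumes "invertible A"
  shows "tri_jet y z F' A' B' \<odot> tri_jet x y F A B =
    tri_jet x z (F' \<circ> F) (A' ** A) (\<lambda>v. B' (F v) ** A + A' ** B v)"
proof -
  let ?L = "\<lambda>(g :: real^3^3) h. (F (fst h), B (fst h) ** g + A ** snd h)"
  let ?K = "\<lambda>(g :: real^3^3) h. (F' (fst h), B' (fst h) ** g + A' ** snd h)"
  have "tri_jet y z F' A' B' \<odot> tri_jet x y F A B =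
      {((x, g), (z, A' ** (A ** g)), ?K (A ** g) \<circ> ?L g) | g. invertible g}"
    unfolding jcomp_def tri_jet_def using invertible_mult[OF assms] by fastforce
  moreover have "?K (A ** g) \<circ> ?L g = (\<lambda>h. ((F' \<circ> F) (fst h),
      (B' (F (fst h)) ** A + A' ** B (fst h)) ** g + A' ** A ** snd h))" for g
    by (simp add: fun_eq_iff matrix_mult_distribs matrix_mul_assoc)
  ultimately show ?thesis
    unfolding tri_jet_def by (simp only: matrix_mul_assoc)
qed

lemma tri_jet_inv:
  assumes "F \<circ> G = id" "G \<circ> F = id" "A ** A' = mat 1" "A' ** A = mat 1"
  shows "jinv (tri_jet x y F A B) = tri_jet y x G A' (\<lambda>v. - (A' ** B (G v) ** A'))"
proof -
  let ?L = "\<lambda>(g :: real^3^3) h. (F (fst h), B (fst h) ** g + A ** snd h)"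
  let ?K = "\<lambda>(g :: real^3^3) h. (G (fst h), - (A' ** B (G (fst h)) ** A') ** g + A' ** snd h)"
  have FG: "F (G v) = v" "G (F v) = v" for v
    using assms by (metis comp_apply id_apply)+
  have A: "A' ** (A ** X) = X" "A ** (A' ** X) = X" for X :: "real^3^3"
    using assms(3,4) by (simp_all add: matrix_mul_assoc)
  have inv: "inv (?L g) = ?K (A ** g)" for g
    by (rule inv_unique_comp)
       (simp_all add: fun_eq_iff FG A matrix_mult_distribs flip: matrix_mul_assoc)
  have "jinv (tri_jet x y F A B) = {((y, A ** g), (x, g), inv (?L g)) | g. invertible g}"
    unfolding jinv_def tri_jet_def by fastforce
  also have "\<dots> = {((y, A ** g), (x, g), ?K (A ** g)) | g. invertible g}"
    by (simp only: inv)
  \<comment> \<open>Reindexing by \<open>A ** g\<close>, which permutes the invertible matrices,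
    makes the new source frame the parameter of the orbit.\<close>
  also have "\<dots> = {((y, g), (x, A' ** g), ?K g) | g. invertible g}"
  proof (intro Collect_cong iffI; elim exE conjE)
    fix p g assume p: "p = ((y, A ** g), (x, g), ?K (A ** g))" "invertible g"
    have "invertible (A ** g)"
      using assms p(2) invertible_def invertible_mult by blast
    with p(1) show "\<exists>g. p = ((y, g), (x, A' ** g), ?K g) \<and> invertible g"
      by (intro exI[of _ "A ** g"]) (simp only: A simp_thms)
  next
    fix p g assume p: "p = ((y, g), (x, A' ** g), ?K g)" "invertible g"
    have "invertible (A' ** g)"
      using assms p(2) invertible_def invertible_mult by blast
    with p(1) show "\<exists>g. p = ((y, A ** g), (x, g), ?K (A ** g)) \<and> invertible g"
      by (intro exI[of _ "A' ** g"]) (simp only: A simp_thms)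
  qed
  finally show ?thesis unfolding tri_jet_def .
qed

lemma src_tri_jet: "src (tri_jet x y F A B) = x"
  and tgt_tri_jet: "tgt (tri_jet x y F A B) = y"
proof -
  have "\<exists>g :: real^3^3. invertible g" using invertible_mat_1 by blast
  then show "src (tri_jet x y F A B) = x" "tgt (tri_jet x y F A B) = y"
    by (auto simp: src_def tgt_def tri_jet_def)
qed

section \<open>Frame fields and the jets they induce\<close>

text \<open>The inverse field is carried as a separate function because, for a multiplicative
  section, it arises as the matrix part of \<open>P (x0, y)\<close> with its own smoothness, not as
  \<open>matrix_inv\<close> of \<open>a\<close>.\<close>

definition frame_field :: "point set \<Rightarrow> (point \<Rightarrow> real^3^3) \<Rightarrow> (point \<Rightarrow> real^3^3) \<Rightarrow> bool" where
  "frame_field U a a' \<longleftrightarrow> open U \<and> smooth_on U a \<and> smooth_on U a' \<and>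
     (\<forall>u\<in>U. a u ** a' u = mat 1 \<and> a' u ** a u = mat 1)"

lemma frame_field_mult:
  fixes X :: "real^3^3"
  assumes "frame_field U a a'" "x \<in> U"
  shows "a x ** a' x = mat 1" "a' x ** a x = mat 1"
    and "X ** a x ** a' x = X" "X ** a' x ** a x = X"
proof -
  show *: "a x ** a' x = mat 1" "a' x ** a x = mat 1"
    using assms by (auto simp: frame_field_def)
  show "X ** a x ** a' x = X" "X ** a' x ** a x = X"
    using * by (simp_all flip: matrix_mul_assoc)
qed

lemma frame_field_has_derivative:
  assumes "frame_field U a a'" "x \<in> U"
  shows "(a has_derivative frechet_derivative a (at x)) (at x)"
    and "(a' has_derivative frechet_derivative a' (at x)) (at x)"
  using assms smooth_on_has_derivative by (auto simp: frame_field_def)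

text \<open>Differentiating the constant product \<open>a u ** a' u\<close> gives this relation,
  which drives the cancellations for pair jets.\<close>

lemma frame_field_derivative_inverse:
  assumes "frame_field U a a'" "x \<in> U"
  shows "frechet_derivative a' (at x) v = - (a' x ** frechet_derivative a (at x) v ** a' x)"
proof -
  let ?a = "frechet_derivative a (at x)" and ?b = "frechet_derivative a' (at x)"
  have "((\<lambda>u. a u ** a' u) has_derivative (\<lambda>v. a x ** ?b v + ?a v ** a' x)) (at x)"
    using frame_field_has_derivative[OF assms]
    by (intro bounded_bilinear.FDERIV[OF bounded_bilinear_matrix_mult])
  then have "((\<lambda>u. mat 1) has_derivative (\<lambda>v. a x ** ?b v + ?a v ** a' x)) (at x)"
    by (rule has_derivative_transform_within_open[of _ _ _ _ U])
       (use assms in \<open>auto simp: frame_field_def\<close>)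
  from has_derivative_unique[OF this has_derivative_const]
  have "a x ** ?b v + ?a v ** a' x = 0" by (simp add: fun_eq_iff)
  then have "a x ** ?b v = - (?a v ** a' x)" by (simp add: eq_neg_iff_add_eq_0)
  then have "a' x ** (a x ** ?b v) = - (a' x ** (?a v ** a' x))"
    by (simp add: matrix_mult_distribs)
  then show ?thesis
    by (simp add: matrix_mul_assoc frame_field_mult[OF assms])
qed

text \<open>
  The jet at \<open>x\<close> of \<open>(u, Z) \<mapsto> (\<psi> u, a' (\<psi> u) ** a u ** Z)\<close>, where \<open>\<psi> x = y\<close> and \<open>F\<close> is the
  derivative of \<open>\<psi>\<close> at \<open>x\<close>.
\<close>

definition pair_jet ::
  "(point \<Rightarrow> real^3^3) \<Rightarrow> (point \<Rightarrow> real^3^3) \<Rightarrow> point \<Rightarrow> point \<Rightarrow> (point \<Rightarrow> point) \<Rightarrow> reduced_jet" where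
  "pair_jet a a' x y F = tri_jet x y F (a' y ** a x)
     (\<lambda>v. a' y ** frechet_derivative a (at x) v + frechet_derivative a' (at y) (F v) ** a x)"

lemma src_pair_jet: "src (pair_jet a a' x y F) = x"
  and tgt_pair_jet: "tgt (pair_jet a a' x y F) = y"
  by (simp_all add: pair_jet_def src_tri_jet tgt_tri_jet)

text \<open>Conjugated translations and prolongations both have this shape near \<open>x\<close>.
  Since only the derivative of \<open>\<psi>\<close> at \<open>x\<close> enters, they can be
  compared through \<open>F\<close>.\<close>

lemma rjet_eq_pair_jet:
  assumes "frame_field U a a'" "open N" "x \<in> N" "x \<in> U" "\<psi> x \<in> U" "(\<psi> has_derivative F) (at x)"
    and "\<And>u Z. u \<in> N \<Longrightarrow> invertible Z \<Longrightarrow> \<Psi> (u, Z) = (\<psi> u, a' (\<psi> u) ** a u ** Z)"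
  shows "rjet x \<Psi> = pair_jet a a' x (\<psi> x) F"
proof -
  have "((\<lambda>u. a' (\<psi> u) ** a u) has_derivative (\<lambda>v. a' (\<psi> x) ** frechet_derivative a (at x) v
      + frechet_derivative a' (at (\<psi> x)) (F v) ** a x)) (at x)"
    by (rule bounded_bilinear.FDERIV[OF bounded_bilinear_matrix_mult
          has_derivative_compose[OF assms(6) frame_field_has_derivative(2)[OF assms(1,5)]]
          frame_field_has_derivative(1)[OF assms(1,4)]])
  from rjet_eq_tri_jet[OF assms(2,3) assms(7) assms(6) this] show ?thesis
    by (simp add: pair_jet_def)
qed

lemma frame_field_invertible:
  assumes "frame_field U a a'" "x \<in> U" "y \<in> U"
  shows "invertible (a x)" "invertible (a' x)" "invertible (a' y ** a x)"
  using frame_field_mult[OF assms(1)] assms(2,3) invertible_def invertible_mult by metis+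

text \<open>At the middle point \<open>y\<close> the derivatives of \<open>a\<close> and of
  \<open>a'\<close> both enter along \<open>F v\<close>; by
  \<open>frame_field_derivative_inverse\<close> the two terms cancel.\<close>

lemma pair_jet_comp:
  assumes f: "frame_field U a a'" and "x \<in> U" "y \<in> U" "z \<in> U"
  shows "pair_jet a a' y z F' \<odot> pair_jet a a' x y F = pair_jet a a' x z (F' \<circ> F)"
  unfolding pair_jet_def tri_jet_comp[OF frame_field_invertible(3)[OF assms(1-3)]]
  using assms(2-4)
  by (simp add: matrix_mul_assoc frame_field_mult[OF f] frame_field_derivative_inverse[OF f]
      matrix_mult_distribs)

lemma pair_jet_inv:
  assumes f: "frame_field U a a'" and "x \<in> U" "y \<in> U" and FG: "F \<circ> G = id" "G \<circ> F = id"
  shows "jinv (pair_jet a a' x y F) = pair_jet a a' y x G"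
proof -
  have inv: "a' y ** a x ** (a' x ** a y) = mat 1" "a' x ** a y ** (a' y ** a x) = mat 1"
    using assms(2,3) by (simp_all add: matrix_mul_assoc frame_field_mult[OF f])
  have "F (G v) = v" for v
    using FG by (metis comp_apply id_apply)
  then show ?thesis
    unfolding pair_jet_def tri_jet_inv[OF FG inv]
    using assms(2,3)
    by (simp add: matrix_mul_assoc frame_field_mult[OF f] frame_field_derivative_inverse[OF f]
      matrix_mult_distribs)
qed

section \<open>Conjugates of translations\<close>

text \<open>The translation carries \<open>\<psi>1 x\<close> to \<open>\<psi>2 y\<close> and has
  identity derivative, so it drops out of the chain rule. Two charts are allowed because an
  integrable section may use different ones at source and target.\<close>

lemma has_derivative_conj_transl:
  assumes "diffeo_on D1 T1 \<psi>1" "x \<in> D1" "diffeo_on D2 T2 \<psi>2" "y \<in> D2"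
  shows "(inv_into D2 \<psi>2 \<circ> transl (\<psi>2 y - \<psi>1 x) \<circ> \<psi>1 has_derivative
    frechet_derivative (inv_into D2 \<psi>2) (at (\<psi>2 y)) \<circ> frechet_derivative \<psi>1 (at x)) (at x)"
proof -
  have t: "(transl (\<psi>2 y - \<psi>1 x) has_derivative (\<lambda>v. v)) (at (\<psi>1 x))"
    unfolding transl_def by (auto intro!: derivative_eq_intros)
  have "((\<lambda>u. inv_into D2 \<psi>2 (transl (\<psi>2 y - \<psi>1 x) (\<psi>1 u))) has_derivative
    (\<lambda>v. frechet_derivative (inv_into D2 \<psi>2) (at (\<psi>2 y)) (frechet_derivative \<psi>1 (at x) v))) (at x)"
    by (rule has_derivative_compose[OF has_derivative_compose[OF diffeo_on_has_derivative(1)[OF assms(1,2)] t]])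
       (use diffeo_on_has_derivative(2)[OF assms(3,4)] in \<open>simp add: transl_def\<close>)
  then show ?thesis by (simp add: comp_def)
qed

lemma diffeo_on_inv_into: "diffeo_on S T f \<Longrightarrow> x \<in> S \<Longrightarrow> inv_into S f (f x) = x"
  by (simp add: diffeo_on_def bij_betw_def)

lemma j1_conj_transl:
  assumes "diffeo_on D1 T1 \<psi>1" "x \<in> D1" "diffeo_on D2 T2 \<psi>2" "y \<in> D2"
  shows "j1 x (inv_into D2 \<psi>2 \<circ> transl (\<psi>2 y - \<psi>1 x) \<circ> \<psi>1) =
    (x, y, matrix (frechet_derivative (inv_into D2 \<psi>2) (at (\<psi>2 y)) \<circ> frechet_derivative \<psi>1 (at x)))"
  unfolding j1_def using frechet_derivative_at[OF has_derivative_conj_transl[OF assms]]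
    diffeo_on_inv_into[OF assms(3,4)]
  by (simp add: transl_def)

lemma transl_apply: "transl v u = u + v"
  by (simp add: transl_def)

lemma Fmap_transl: "Fmap (transl v) z = (fst z + v, snd z)"
proof -
  have "(transl v has_derivative (\<lambda>v. v)) (at x)" for x
    unfolding transl_def by (auto intro!: derivative_eq_intros)
  then have "frechet_derivative (transl v) (at x) = id" for x
    using frechet_derivative_at by (metis eq_id_iff)
  then show ?thesis
    by (simp add: Fmap_def matrix_id_mat_1) (simp add: transl_def)
qed

lemma inv_into_bundle_map:
  assumes f: "frame_field U a a'" and "inj_on k U"
    and \<kappa>: "\<And>z. z \<in> FB U \<Longrightarrow> \<kappa> z = (k (fst z), a (fst z) ** snd z)"
  shows "inj_on \<kappa> (FB U)"
    and "w \<in> U \<Longrightarrow> invertible Z \<Longrightarrow> inv_into (FB U) \<kappa> (k w, Z) = (w, a' w ** Z)"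
proof -
  show inj: "inj_on \<kappa> (FB U)"
  proof (rule inj_onI)
    fix z z' assume z: "z \<in> FB U" "z' \<in> FB U" "\<kappa> z = \<kappa> z'"
    then have k: "k (fst z) = k (fst z')" and a: "a (fst z) ** snd z = a (fst z') ** snd z'"
      using \<kappa> by auto
    have U: "fst z \<in> U" "fst z' \<in> U" using z by (auto simp: FB_def)
    with k assms(2) have 1: "fst z = fst z'" by (auto dest: inj_onD)
    with a have "a' (fst z) ** (a (fst z) ** snd z) = a' (fst z) ** (a (fst z) ** snd z')" by simp
    then have "snd z = snd z'" using U by (simp add: matrix_mul_assoc frame_field_mult[OF f])
    with 1 show "z = z'" by (simp add: prod_eq_iff)
  qed
  assume w: "w \<in> U" "invertible Z"
  have mem: "(w, a' w ** Z) \<in> FB U"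
    using w invertible_mult[OF frame_field_invertible(2)[OF f w(1) w(1)] w(2)] by (simp add: FB_def)
  moreover have "\<kappa> (w, a' w ** Z) = (k w, Z)"
    using \<kappa>[OF mem] w by (simp add: matrix_mul_assoc frame_field_mult[OF f])
  ultimately show "inv_into (FB U) \<kappa> (k w, Z) = (w, a' w ** Z)"
    using inv_into_f_f[OF inj mem] by simp
qed

lemma rjet_conj_transl:
  assumes f: "frame_field U a a'" and d: "diffeo_on U (k ` U) k"
    and \<kappa>: "\<And>z. z \<in> FB U \<Longrightarrow> \<kappa> z = (k (fst z), a (fst z) ** snd z)"
    and "x \<in> U" "y \<in> U"
  shows "rjet x (inv_into (FB U) \<kappa> \<circ> Fmap (transl (base_map \<kappa> y - base_map \<kappa> x)) \<circ> \<kappa>) =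
    pair_jet a a' x y (frechet_derivative (inv_into U k) (at (k y)) \<circ> frechet_derivative k (at x))"
proof -
  define v where "v = k y - k x"
  \<comment> \<open>Over \<open>N\<close> the translated point stays in the image of
    \<open>k\<close>, so \<open>inv_into\<close> really inverts \<open>\<kappa>\<close> there; a
    neighbourhood of \<open>x\<close> suffices for the jet.\<close>
  define N where "N = U \<inter> k -` ((\<lambda>w. w - v) ` (k ` U))"
  have inj: "inj_on k U" and U: "open U" "open (k ` U)" and cont: "continuous_on U k"
    using d by (auto simp: diffeo_on_def bij_betw_def smooth_on_imp_continuous_on)
  have base: "base_map \<kappa> u = k u" if "u \<in> U" for u
    using \<kappa>[of "(u, mat 1)"] that by (simp add: base_map_def FB_def invertible_mat_1)
  have "open N"
    unfolding N_def using U cont by (intro continuous_open_preimage open_translation_subtract)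
  moreover have "x \<in> N"
    using assms by (auto simp: N_def v_def intro!: image_eqI[of _ _ "k y"])
  moreover have "(inv_into (FB U) \<kappa> \<circ> Fmap (transl v) \<circ> \<kappa>) (u, Z) =
      ((inv_into U k \<circ> transl v \<circ> k) u, a' ((inv_into U k \<circ> transl v \<circ> k) u) ** a u ** Z)"
    if un: "u \<in> N" and Z: "invertible Z" for u Z
  proof -
    have u: "u \<in> U" using un by (simp add: N_def)
    obtain w where "w \<in> U" "k u = k w - v" using un unfolding N_def by blast
    then have w: "w \<in> U" "k u + v = k w" by simp_all
    have "invertible (a u ** Z)"
      using invertible_mult[OF frame_field_invertible(1)[OF f u u] Z] .
    from inv_into_bundle_map(2)[OF f inj \<kappa> w(1) this] u Z show ?thesis
      by (simp add: \<kappa> FB_def Fmap_transl w(2) transl_apply inv_into_f_f[OF inj w(1)] matrix_mul_assoc)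
  qed
  moreover have "(inv_into U k \<circ> transl v \<circ> k) x = y"
    using assms inj by (simp add: v_def transl_def)
  ultimately show ?thesis
    using rjet_eq_pair_jet[OF f, of N x "inv_into U k \<circ> transl v \<circ> k"]
      has_derivative_conj_transl[OF d \<open>x \<in> U\<close> d \<open>y \<in> U\<close>] assms(4,5)
    by (simp add: base v_def)
qed

text \<open>\<open>section_rep\<close> is an arbitrary choice, but its value and derivative at
  \<open>x\<close> are prescribed by \<open>Q (x, y)\<close>, and nothing else about it survives in
  the reduced jet.\<close>

lemma prolongation_eq_pair_jet:
  assumes f: "frame_field U a a'" and P: "\<And>u w. u \<in> U \<Longrightarrow> w \<in> U \<Longrightarrow> P (u, w) = (u, w, a' w ** a u)"
    and "x \<in> U" "y \<in> U" and Q: "Q (x, y) = (x, y, M)" "Q (x, y) \<in> Pi1 U"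
  shows "prolongation U P Q (x, y) = pair_jet a a' x y ((*v) M)"
proof -
  define \<psi> where "\<psi> = section_rep U Q (x, y)"
  have "represents U \<psi> (x, y, M)"
    using Q someI_ex[of "\<lambda>\<psi>. represents U \<psi> (x, y, M)"]
    unfolding \<psi>_def section_rep_def Pi1_def by simp
  then obtain V V' where V: "diffeo_on V V' \<psi>" "V \<subseteq> U" "V' \<subseteq> U" "x \<in> V" "j1 x \<psi> = (x, y, M)"
    unfolding represents_def by auto
  have \<psi>x: "\<psi> x = y" and M: "M = matrix (frechet_derivative \<psi> (at x))"
    using V(5) by (auto simp: j1_def)
  have der: "(\<psi> has_derivative ((*v) M)) (at x)"
    using diffeo_on_has_derivative(1)[OF V(1,4)] unfolding M
    by (simp add: matrix_vector_mul_frechet_derivative)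
  \<comment> \<open>Domain and image of the representative both lie in \<open>U\<close>, so the
    split form of \<open>P\<close> is available at \<open>(u, \<psi> u)\<close>.\<close>
  have "section_bar P \<psi> (u, Z) = (\<psi> u, a' (\<psi> u) ** a u ** Z)" if "u \<in> V" for u Z
  proof -
    have "\<psi> u \<in> V'" using V(1) that by (auto simp: diffeo_on_def bij_betw_def)
    then have "u \<in> U" "\<psi> u \<in> U" using that V by auto
    then show ?thesis by (simp add: P section_bar_def)
  qed
  from rjet_eq_pair_jet[OF f _ V(4) assms(3) _ der this] V(1) assms(4) show ?thesis
    by (simp add: prolongation_def \<psi>_def[symmetric] \<psi>x diffeo_on_def)
qed

section \<open>Deformations as pairs of a chart and a field of frames\<close>

text \<open>Every frame over \<open>u\<close> is \<open>(u, mat 1) \<cdot> Z\<close>, so an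
  equivariant map is determined by its values along the smooth section of frames
  \<open>(u, mat 1)\<close>.\<close>

lemma equivariant_smooth_normal_form:
  assumes "open U" "equivariant_on U \<Psi>" "smooth_on (FB U) \<Psi>" "\<Psi> ` FB U \<subseteq> FB UNIV"
  defines "a \<equiv> \<lambda>u. snd (\<Psi> (u, mat 1))"
  shows "smooth_on U (base_map \<Psi>)" "smooth_on U a" "\<And>u. u \<in> U \<Longrightarrow> invertible (a u)"
    and "\<And>u Z. u \<in> U \<Longrightarrow> invertible Z \<Longrightarrow> \<Psi> (u, Z) = (base_map \<Psi> u, a u ** Z)"
proof -
  have mem: "(u, mat 1) \<in> FB U" if "u \<in> U" for u
    using that by (simp add: FB_def invertible_mat_1)
  have "smooth_on U (\<lambda>u. \<Psi> (u, mat 1))"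
  proof (rule smooth_on_compose[OF assms(1) open_FB[OF assms(1)] _ _ assms(3)])
    show "(\<lambda>u. (u, mat 1)) ` U \<subseteq> FB U" using mem by auto
    show "smooth_on U (\<lambda>u. (u, mat 1 :: real^3^3))"
      by (intro smooth_on_Pair smooth_on_ident smooth_on_const assms(1))
  qed
  then show "smooth_on U (base_map \<Psi>)" "smooth_on U a"
    unfolding base_map_def[abs_def] a_def using assms(1) smooth_on_fst smooth_on_snd by blast+
  show "invertible (a u)" if "u \<in> U" for u
  proof -
    have "\<Psi> (u, mat 1) \<in> FB UNIV" using assms(4) mem[OF that] by blast
    then show ?thesis by (auto simp: FB_def a_def)
  qed
  show "\<Psi> (u, Z) = (base_map \<Psi> u, a u ** Z)" if "u \<in> U" "invertible Z" for u Z
  proof -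
    have "\<Psi> ((u, mat 1) \<cdot> Z) = \<Psi> (u, mat 1) \<cdot> Z"
      using assms(2) mem[OF that(1)] that(2) unfolding equivariant_on_def by blast
    then show ?thesis by (simp add: frame_act_def base_map_def a_def)
  qed
qed

lemma invertible_matrix_if_inj:
  fixes f :: "real^'n \<Rightarrow> real^'n"
  assumes "(f has_derivative f') (at x)" "\<And>v. f' v = 0 \<Longrightarrow> v = 0"
  shows "invertible (matrix f')"
proof -
  have "inj f'"
    using assms linear_injective_0[OF has_derivative_linear[OF assms(1)]] by blast
  then have "inj ((*v) (matrix f'))"
    by (simp only: matrix_vector_mul_frechet_derivative[OF assms(1)])
  then show ?thesis
    by (simp only: invertible_left_inverse matrix_left_invertible_injective)
qed

text \<open>Injectivity and immersivity are given for \<open>\<kappa>\<close> on frames but needed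
  for \<open>k\<close> on points. A failure on the base would lift to frames, since
  \<open>a'\<close> allows the matrix component to be corrected.\<close>

lemma deformation_normal_form:
  assumes "deformation U \<kappa>"
  obtains k a a' where "frame_field U a a'" "diffeo_on U (k ` U) k"
    "\<And>z. z \<in> FB U \<Longrightarrow> \<kappa> z = (k (fst z), a (fst z) ** snd z)"
proof -
  define k where "k = base_map \<kappa>"
  define a where "a = (\<lambda>u. snd (\<kappa> (u, mat 1)))"
  define a' where "a' = (\<lambda>u. matrix_inv (a u))"
  have U: "open U" and inj': "\<And>z. z \<in> FB U \<Longrightarrow> inj (frechet_derivative \<kappa> (at z))"
    and "inj_on \<kappa> (FB U)"
    using assms unfolding pb_embedding_def homeomorphism_def by (auto intro: inj_on_inverseI)
  have nf: "smooth_on U k" "smooth_on U a" "\<And>u. u \<in> U \<Longrightarrow> invertible (a u)"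
    "\<And>u Z. u \<in> U \<Longrightarrow> invertible Z \<Longrightarrow> \<kappa> (u, Z) = (k u, a u ** Z)"
    using equivariant_smooth_normal_form[of U \<kappa>] assms unfolding pb_embedding_def k_def a_def by auto
  have "smooth_on U a'"
    unfolding a'_def
    by (rule smooth_on_compose[OF U open_invertible _ nf(2) smooth_on_matrix_inv]) (use nf(3) in auto)
  then have ff: "frame_field U a a'"
    using U nf(2,3) by (simp add: frame_field_def a'_def matrix_inv_left_real matrix_inv_right_real)
  have "inj_on k U"
  proof (rule inj_onI)
    fix x y assume xy: "x \<in> U" "y \<in> U" "k x = k y"
    \<comment> \<open>Chosen so that the frames \<open>(y, ?Z)\<close> and \<open>(x, mat 1)\<close>
      have the same image under \<open>\<kappa>\<close>.\<close>
    let ?Z = "a' y ** a x"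
    have Z: "invertible ?Z" using frame_field_invertible(3)[OF ff xy(1,2)] .
    have "\<kappa> (y, ?Z) = \<kappa> (x, mat 1)"
      using nf(4)[OF xy(2) Z] nf(4)[OF xy(1) invertible_mat_1] xy frame_field_mult[OF ff xy(2)]
      by (simp add: matrix_mul_assoc)
    then have "(y, ?Z) = (x, mat 1)"
      using \<open>inj_on \<kappa> (FB U)\<close> xy Z by (auto dest!: inj_onD simp: FB_def invertible_mat_1)
    then show "x = y" by simp
  qed
  moreover have "invertible (matrix (frechet_derivative k (at x)))" if x: "x \<in> U" for x
  proof (rule invertible_matrix_if_inj[OF smooth_on_has_derivative[OF nf(1) x]])
    let ?k' = "frechet_derivative k (at x)" and ?a' = "frechet_derivative a (at x)"
    let ?D = "\<lambda>h. (?k' (fst h), ?a' (fst h) ** mat 1 + a x ** snd h)"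
    fix v assume v: "?k' v = 0"
    have D: "(\<kappa> has_derivative ?D) (at (x, mat 1))"
      by (rule has_derivative_bundle_map[OF U x invertible_mat_1 nf(4)
            smooth_on_has_derivative[OF nf(1) x] smooth_on_has_derivative[OF nf(2) x]])
    have "inj ?D"
      using inj'[of "(x, mat 1)"] x frechet_derivative_at[OF D] by (simp add: FB_def invertible_mat_1)
    \<comment> \<open>The fibre component compensates the variation of \<open>a\<close> along
      \<open>v\<close>, so a kernel vector of the derivative of \<open>k\<close> lifts to one of the
      derivative of \<open>\<kappa>\<close>.\<close>
    moreover have "?D (v, - (a' x ** ?a' v)) = ?D (0, 0)"
      using v linear_0[OF has_derivative_linear[OF smooth_on_has_derivative[OF nf(1) x]]]
        linear_0[OF has_derivative_linear[OF smooth_on_has_derivative[OF nf(2) x]]]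
      by (simp add: matrix_mult_distribs matrix_mul_assoc frame_field_mult[OF ff x])
    ultimately have "(v, - (a' x ** ?a' v)) = (0, 0)"
      by (rule injD)
    then show "v = 0" by simp
  qed
  ultimately have "diffeo_on U (k ` U) k"
    by (intro smooth_inverse U nf(1))
  moreover have "\<kappa> z = (k (fst z), a (fst z) ** snd z)" if "z \<in> FB U" for z
    using nf(4) that by (auto simp: FB_def)
  ultimately show thesis using that ff by blast
qed

text \<open>The derivative is block triangular, with the derivative of \<open>k\<close> and
  multiplication by \<open>a x\<close> on the diagonal; the inverse is explicit in terms of
  \<open>inv_into U k\<close> and \<open>a'\<close>.\<close>

lemma deformation_of_chart:
  assumes ff: "frame_field U a a'" and d: "diffeo_on U (k ` U) k"
  defines "\<kappa> \<equiv> \<lambda>z. (k (fst z), a (fst z) ** snd z)"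
  shows "deformation U \<kappa>"
proof -
  have U: "open U" "open (FB U)" and k: "smooth_on U k" "inj_on k U" "smooth_on (k ` U) (inv_into U k)"
    and a: "smooth_on U a" "smooth_on U a'"
    using d ff by (auto simp: diffeo_on_def frame_field_def bij_betw_def open_FB)
  have fst: "smooth_on (FB U) (\<lambda>z. f (fst z))" if "smooth_on U f"
    for f :: "point \<Rightarrow> 'b::real_normed_vector"
    by (rule smooth_on_compose[OF U(2,1) _ _ that])
       (auto simp: FB_def intro: smooth_on_bounded_linear[OF _ bounded_linear_fst] U(2)[unfolded FB_def])
  have smooth: "smooth_on (FB U) \<kappa>"
    unfolding \<kappa>_def
    by (rule smooth_on_Pair[OF U(2) fst[OF k(1)] smooth_on_matrix_mult[OF U(2) fst[OF a(1)]
          smooth_on_bounded_linear[OF U(2) bounded_linear_snd]]])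
  have im: "\<kappa> z \<in> k ` U \<times> {A. invertible A}" if "z \<in> FB U" for z
    using that invertible_mult[OF frame_field_invertible(1)[OF ff]] by (auto simp: \<kappa>_def FB_def)
  have inj: "inj (frechet_derivative \<kappa> (at z))" if z: "z \<in> FB U" for z
  proof -
    obtain x g where xg: "z = (x, g)" "x \<in> U" "invertible g" using z by (auto simp: FB_def)
    let ?k' = "frechet_derivative k (at x)" and ?a' = "frechet_derivative a (at x)"
    let ?D = "\<lambda>h. (?k' (fst h), ?a' (fst h) ** g + a x ** snd h)"
    have D: "(\<kappa> has_derivative ?D) (at z)"
      unfolding xg(1)
      by (rule has_derivative_bundle_map[OF U(1) xg(2,3) _ diffeo_on_has_derivative(1)[OF d xg(2)]
            smooth_on_has_derivative[OF a(1) xg(2)]]) (simp add: \<kappa>_def)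
    have "h = 0" if "?D h = 0" for h
    proof -
      have h: "?k' (fst h) = 0" "?a' (fst h) ** g + a x ** snd h = 0"
        using that by (simp_all add: zero_prod_def)
      have "frechet_derivative (inv_into U k) (at (k x)) (?k' (fst h)) = fst h"
        using diffeo_on_derivative_inverse(1)[OF d xg(2)] by (metis comp_apply id_apply)
      then have 1: "fst h = 0"
        using h(1) linear_0[OF has_derivative_linear[OF diffeo_on_has_derivative(2)[OF d xg(2)]]] by simp
      then have "a x ** snd h = 0"
        using h(2) linear_0[OF has_derivative_linear[OF smooth_on_has_derivative[OF a(1) xg(2)]]] by simp
      then have "a' x ** (a x ** snd h) = 0" by simp
      then have "snd h = 0" by (simp add: matrix_mul_assoc frame_field_mult[OF ff xg(2)])
      with 1 show ?thesis by (simp add: prod_eq_iff)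
    qed
    then have "inj ?D"
      using linear_injective_0[OF has_derivative_linear[OF D]] by blast
    then show ?thesis using frechet_derivative_at[OF D] by simp
  qed
  define \<theta> where "\<theta> = (\<lambda>w :: frame. (inv_into U k (fst w), a' (inv_into U k (fst w)) ** snd w))"
  have "homeomorphism (FB U) (\<kappa> ` FB U) \<kappa> \<theta>"
  proof (rule homeomorphismI)
    show "continuous_on (FB U) \<kappa>" using smooth by (rule smooth_on_imp_continuous_on)
    have 1: "continuous_on (\<kappa> ` FB U) (\<lambda>w. inv_into U k (fst w))"
      by (rule continuous_on_compose2[OF smooth_on_imp_continuous_on[OF k(3)] continuous_on_fst[OF continuous_on_id]])
         (use im in fastforce)
    have "continuous_on (\<kappa> ` FB U) (\<lambda>w. a' (inv_into U k (fst w)))"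
      by (rule continuous_on_compose2[OF smooth_on_imp_continuous_on[OF a(2)] 1])
         (use im in \<open>fastforce intro: inv_into_into\<close>)
    then show "continuous_on (\<kappa> ` FB U) \<theta>"
      unfolding \<theta>_def
      by (intro continuous_on_Pair 1 bounded_bilinear.continuous_on[OF bounded_bilinear_matrix_mult]
          continuous_on_snd continuous_on_id)
    have \<theta>: "\<theta> (\<kappa> z) = z" if "z \<in> FB U" for z
    proof -
      have "fst z \<in> U" using that by (auto simp: FB_def)
      then show ?thesis
        using k(2) by (simp add: \<theta>_def \<kappa>_def matrix_mul_assoc frame_field_mult[OF ff] prod_eq_iff)
    qed
    then show "\<theta> ` \<kappa> ` FB U \<subseteq> FB U" "\<And>y. y \<in> \<kappa> ` FB U \<Longrightarrow> \<kappa> (\<theta> y) = y"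
      "\<And>x. x \<in> FB U \<Longrightarrow> \<theta> (\<kappa> x) = x" by auto
  qed auto
  then show ?thesis
    unfolding pb_embedding_def
    using U(1) smooth inj im
    by (fastforce simp: equivariant_on_def frame_act_def \<kappa>_def matrix_mul_assoc FB_def)
qed

section \<open>Sections and prolongations\<close>

lemma Pi1_I:
  assumes "open U" "x \<in> U" "y \<in> U" "invertible A"
  shows "(x, y, A) \<in> Pi1 U"
proof -
  \<comment> \<open>An affine map realises the prescribed jet; restricting it to \<open>V\<close>
    keeps domain and image inside \<open>U\<close>.\<close>
  define \<psi> where "\<psi> = (\<lambda>u. A *v (u - x) + y)"
  define V where "V = \<psi> -` U \<inter> U"
  have der: "(\<psi> has_derivative ((*v) A)) (at u)" for u
    unfolding \<psi>_def
    by (auto intro!: derivative_eq_intros bounded_linear.has_derivative[OF matrix_vector_mul_bounded_linear])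
  then have D: "frechet_derivative \<psi> (at u) = (*v) A" for u
    using frechet_derivative_at by metis
  have "open V"
    unfolding V_def using has_derivative_continuous[OF der] assms(1)
    by (intro continuous_open_vimage open_Int) auto
  have "smooth_on V \<psi>"
  proof -
    have "smooth_on V (\<lambda>u. A *v u + (y - A *v x))"
      using \<open>open V\<close> by (intro smooth_on_add smooth_on_bounded_linear smooth_on_const) auto
    then show ?thesis by (simp add: \<psi>_def algebra_simps)
  qed
  moreover have "inj_on \<psi> V"
  proof (rule inj_onI)
    fix u w assume "\<psi> u = \<psi> w"
    then have "matrix_inv A *v (A *v (u - x)) = matrix_inv A *v (A *v (w - x))" by (simp add: \<psi>_def)
    then show "u = w"
      by (simp add: matrix_vector_mul_assoc matrix_inv_left_real[OF assms(4)])
  qed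
  ultimately have "diffeo_on V (\<psi> ` V) \<psi>"
    using assms(4) by (intro smooth_inverse \<open>open V\<close>) (auto simp: D)
  moreover have "x \<in> V" "j1 x \<psi> = (x, y, A)"
    using assms by (auto simp: V_def \<psi>_def j1_def D[unfolded \<psi>_def])
  ultimately have "represents U \<psi> (x, y, A)"
    unfolding represents_def by (intro exI[of _ V] exI[of _ "\<psi> ` V"]) (auto simp: V_def)
  then show ?thesis unfolding Pi1_def by blast
qed

text \<open>Serves both sections built from a deformation: \<open>P\<close> splits through the frame
  field, and the Jacobians in \<open>Q\<close> split through those of the chart and its
  inverse.\<close>

lemma pi1_section_split:
  assumes "open U" "smooth_on U b" "smooth_on U c"
    and "\<And>u. u \<in> U \<Longrightarrow> invertible (b u) \<and> invertible (c u)"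
  shows "pi1_section U (\<lambda>(x, y). (x, y, c y ** b x))"
proof -
  have U2: "open (U \<times> U)" using assms(1) by (simp add: open_Times)
  have f: "smooth_on (U \<times> U) (fst :: point \<times> point \<Rightarrow> _)" "smooth_on (U \<times> U) (snd :: point \<times> point \<Rightarrow> _)"
    using U2 by (auto intro: smooth_on_bounded_linear bounded_linear_fst bounded_linear_snd)
  have "smooth_on (U \<times> U) (\<lambda>p. (fst p, snd p, c (snd p) ** b (fst p)))"
    by (intro smooth_on_Pair U2 f smooth_on_matrix_mult
        smooth_on_compose[OF U2 assms(1) _ f(1) assms(2)]
        smooth_on_compose[OF U2 assms(1) _ f(2) assms(3)]) auto
  then show ?thesis
    using assms by (auto simp: pi1_section_def case_prod_unfold intro!: Pi1_I invertible_mult)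
qed

lemma matrix_derivative_conj_transl:
  fixes \<psi>1 \<psi>2 :: "point \<Rightarrow> point"
  assumes "diffeo_on D1 T1 \<psi>1" "x \<in> D1" "diffeo_on D2 T2 \<psi>2" "y \<in> D2"
  shows "matrix (frechet_derivative (inv_into D2 \<psi>2) (at (\<psi>2 y)) \<circ> frechet_derivative \<psi>1 (at x)) =
    matrix (frechet_derivative (inv_into D2 \<psi>2) (at (\<psi>2 y))) ** matrix (frechet_derivative \<psi>1 (at x))"
  using matrix_compose[OF has_derivative_linear[OF diffeo_on_has_derivative(1)[OF assms(1,2)]]
      has_derivative_linear[OF diffeo_on_has_derivative(2)[OF assms(3,4)]]] .

lemma diffeo_on_invertible:
  fixes \<psi> :: "point \<Rightarrow> point"
  assumes "diffeo_on S T \<psi>" "x \<in> S"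
  shows "invertible (matrix (frechet_derivative \<psi> (at x)))"
    and "invertible (matrix (frechet_derivative (inv_into S \<psi>) (at (\<psi> x))))"
proof -
  let ?M = "matrix (frechet_derivative \<psi> (at x))"
    and ?N = "matrix (frechet_derivative (inv_into S \<psi>) (at (\<psi> x)))"
  have "?N ** ?M = mat 1"
    using matrix_derivative_conj_transl[OF assms assms] diffeo_on_derivative_inverse(1)[OF assms]
    by (simp add: matrix_id_mat_1)
  moreover from this have "?M ** ?N = mat 1" by (rule iffD1[OF matrix_left_right_inverse])
  ultimately show "invertible ?M" "invertible ?N" by (auto simp: invertible_def)
qed

lemma Pi1_invertible:
  assumes "(x, y, A) \<in> Pi1 U"
  shows "invertible A"
proof -
  obtain \<psi> V V' where "diffeo_on V V' \<psi>" "x \<in> V" "j1 x \<psi> = (x, y, A)"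
    using assms unfolding Pi1_def represents_def by auto
  then show ?thesis using diffeo_on_invertible(1) by (auto simp: j1_def)
qed

section \<open>Homogeneous sets and multiplicative prolongations\<close>

lemma homogeneous_set_prolongation:
  assumes "homogeneous_set B W U"
  shows "\<exists>P Q. multiplicative_section U P \<and> integrable_prolongation_in U (material_groupoid B W) P Q"
proof -
  obtain \<kappa> where \<kappa>: "deformation U \<kappa>"
    "\<And>x y. x \<in> U \<Longrightarrow> y \<in> U \<Longrightarrow>
      rjet x (inv_into (FB U) \<kappa> \<circ> Fmap (transl (base_map \<kappa> y - base_map \<kappa> x)) \<circ> \<kappa>)
        \<in> material_groupoid B W"
    using assms unfolding homogeneous_set_def by blast
  obtain k a a' where ff: "frame_field U a a'" and d: "diffeo_on U (k ` U) k"
    and nf: "\<And>z. z \<in> FB U \<Longrightarrow> \<kappa> z = (k (fst z), a (fst z) ** snd z)"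
    using deformation_normal_form[OF \<kappa>(1)] by metis
  have U: "open U" and a: "smooth_on U a" "smooth_on U a'"
    using ff by (auto simp: frame_field_def)
  have kU: "open (k ` U)" "smooth_on U k" "smooth_on (k ` U) (inv_into U k)"
    using d by (auto simp: diffeo_on_def)
  define P where "P = (\<lambda>(x, y). (x, y, a' y ** a x))"
  define M where "M x = matrix (frechet_derivative k (at x))" for x
  define M' where "M' y = matrix (frechet_derivative (inv_into U k) (at (k y)))" for y
  define Q where "Q = (\<lambda>(x, y). (x, y, M' y ** M x))"
  have sM: "smooth_on U M"
    unfolding M_def using U kU(2) by (rule smooth_on_matrix_frechet_derivative)
  have sM': "smooth_on U M'"
    unfolding M'_def
    by (rule smooth_on_compose[OF U kU(1) _ kU(2) smooth_on_matrix_frechet_derivative[OF kU(1,3)]]) simp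
  have Q: "pi1_section U Q"
    unfolding Q_def using diffeo_on_invertible[OF d]
    by (intro pi1_section_split[OF U sM sM']) (simp add: M_def M'_def)
  have P: "pi1_section U P"
    unfolding P_def using frame_field_invertible[OF ff] by (intro pi1_section_split U a) auto
  have Mk: "matrix (frechet_derivative (inv_into U k) (at (k y)) \<circ> frechet_derivative k (at x)) = M' y ** M x"
    if "x \<in> U" "y \<in> U" for x y
    unfolding M_def M'_def using matrix_derivative_conj_transl[OF d that(1) d that(2)] .
  \<comment> \<open>The chart \<open>k\<close> is defined on all of \<open>U\<close>, so it serves
    at both ends of every pair of points.\<close>
  have "integrable_section U Q"
    unfolding integrable_section_def
  proof (intro ballI)
    fix x0 y0 assume "x0 \<in> U" "y0 \<in> U"
    then show "\<exists>D1 D2 \<psi>1 \<psi>2.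
        x0 \<in> D1 \<and> D1 \<subseteq> U \<and> diffeo_on D1 (\<psi>1 ` D1) \<psi>1 \<and>
        y0 \<in> D2 \<and> D2 \<subseteq> U \<and> diffeo_on D2 (\<psi>2 ` D2) \<psi>2 \<and>
        (\<forall>x\<in>D1. \<forall>y\<in>D2.
           Q (x, y) = j1 x (inv_into D2 \<psi>2 \<circ> transl (\<psi>2 y - \<psi>1 x) \<circ> \<psi>1))"
      by (intro exI[of _ U] exI[of _ k]) (simp add: d Q_def Mk j1_conj_transl[OF d _ d])
  qed
  moreover have "prolongation U P Q (x, y) \<in> material_groupoid B W" if xy: "x \<in> U" "y \<in> U" for x y
  proof -
    have "prolongation U P Q (x, y) = pair_jet a a' x y ((*v) (M' y ** M x))"
      by (rule prolongation_eq_pair_jet[OF ff _ xy])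
         (use Q xy in \<open>auto simp: P_def Q_def pi1_section_def\<close>)
    also have "(*v) (M' y ** M x) =
        frechet_derivative (inv_into U k) (at (k y)) \<circ> frechet_derivative k (at x)"
      using matrix_vector_mul_frechet_derivative[OF has_derivative_conj_transl[OF d xy(1) d xy(2)]]
      by (simp add: Mk xy)
    also have "pair_jet a a' x y \<dots> =
        rjet x (inv_into (FB U) \<kappa> \<circ> Fmap (transl (base_map \<kappa> y - base_map \<kappa> x)) \<circ> \<kappa>)"
      using rjet_conj_transl[OF ff d nf xy] by simp
    finally show ?thesis using \<kappa>(2)[OF xy] by simp
  qed
  ultimately have "integrable_prolongation_in U (material_groupoid B W) P Q"
    using P Q by (simp add: integrable_prolongation_in_def)
  moreover have "multiplicative_section U P"
    by (auto simp: multiplicative_section_def P_def matrix_mul_assoc frame_field_mult[OF ff])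
  ultimately show ?thesis by blast
qed

lemma lie_subgroupoidD:
  assumes "lie_subgroupoid M N \<Omega>"
  shows "N \<subseteq> M" "\<Omega> \<subseteq> Jt M" "\<And>c. c \<in> \<Omega> \<Longrightarrow> src c \<in> N"
    and "\<And>c d. c \<in> \<Omega> \<Longrightarrow> d \<in> \<Omega> \<Longrightarrow> src d = tgt c \<Longrightarrow> d \<odot> c \<in> \<Omega>"
    and "\<And>c. c \<in> \<Omega> \<Longrightarrow> jinv c \<in> \<Omega>"
proof -
  note 1 = assms[unfolded lie_subgroupoid_def]
  note 2 = conjunct2[OF 1]
  note 3 = conjunct2[OF 2]
  note 4 = conjunct2[OF conjunct2[OF 3]]
  show "N \<subseteq> M" "\<Omega> \<subseteq> Jt M"
    by (rule conjunct1[OF 1], rule conjunct1[OF 2])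
  show "src c \<in> N" if "c \<in> \<Omega>" for c
    using conjunct1[OF 3] that by simp
  show "d \<odot> c \<in> \<Omega>" if "c \<in> \<Omega>" "d \<in> \<Omega>" "src d = tgt c" for c d
    using conjunct1[OF 4] that by simp
  show "jinv c \<in> \<Omega>" if "c \<in> \<Omega>" for c
    using conjunct1[OF conjunct2[OF 4]] that by simp
qed

text \<open>
  The charts \<open>\<psi>1\<close>, \<open>\<psi>2\<close> around \<open>x0\<close> that integrate \<open>Q\<close> may differ, so the prolongation itself need
  not consist of jets of conjugated translations. The composites of its jet from \<open>x0\<close> to \<open>y\<close> with
  the inverse of its jet from \<open>x0\<close> to \<open>x\<close> only involve \<open>\<psi>2\<close>.
\<close>

lemma multiplicative_prolongation_homogeneous_set:
  assumes mult: "multiplicative_section U P"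
    and ip: "integrable_prolongation_in U (material_groupoid B W) P Q"
    and lie: "lie_subgroupoid B N (material_groupoid B W)" and "open U" and x0: "x0 \<in> U"
  shows "\<exists>D. open D \<and> D \<subseteq> U \<and> x0 \<in> D \<and> homogeneous_set B W D"
proof -
  let ?\<Omega> = "material_groupoid B W"
  have sec: "pi1_section U P" "pi1_section U Q" and int: "integrable_section U Q"
    and \<Omega>: "\<And>x y. x \<in> U \<Longrightarrow> y \<in> U \<Longrightarrow> prolongation U P Q (x, y) \<in> ?\<Omega>"
    using ip by (auto simp: integrable_prolongation_in_def)
  define p where "p x y = snd (snd (P (x, y)))" for x y
  have P: "P (x, y) = (x, y, p x y)" "(x, y, p x y) \<in> Pi1 U" if "x \<in> U" "y \<in> U" for x y
  proof -
    have "P (x, y) \<in> Pi1 U" "fst (P (x, y)) = x" "fst (snd (P (x, y))) = y"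
      using sec(1) that by (auto simp: pi1_section_def)
    then show "P (x, y) = (x, y, p x y)" "(x, y, p x y) \<in> Pi1 U"
      unfolding p_def by (metis prod.collapse)+
  qed
  have p_mult: "p y z ** p x y = p x z" if "x \<in> U" "y \<in> U" "z \<in> U" for x y z
    using mult that by (auto simp: multiplicative_section_def P)
  \<comment> \<open>Multiplicativity makes \<open>p x x\<close> idempotent, and an invertible
    idempotent is the identity.\<close>
  have p_id: "p x x = mat 1" if "x \<in> U" for x
  proof -
    have "invertible (p x x)" using Pi1_invertible P(2) that by blast
    moreover have "matrix_inv (p x x) ** (p x x ** p x x) = matrix_inv (p x x) ** p x x"
      by (simp add: p_mult that)
    ultimately show ?thesis by (simp add: matrix_mul_assoc matrix_inv_left_real)
  qed
  define a where "a x = p x x0" for x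
  define a' where "a' y = p x0 y" for y
  have "open (U \<times> U)" using \<open>open U\<close> by (simp add: open_Times)
  have smooth_p: "smooth_on (U \<times> U) (\<lambda>q. snd (snd (P q)))"
    using sec(1) \<open>open (U \<times> U)\<close> by (intro smooth_on_snd) (auto simp: pi1_section_def)
  have "smooth_on U a"
    unfolding a_def p_def
    by (rule smooth_on_compose[OF \<open>open U\<close> \<open>open (U \<times> U)\<close> _ _ smooth_p])
       (use x0 \<open>open U\<close> in \<open>auto intro!: smooth_on_Pair smooth_on_ident smooth_on_const\<close>)
  moreover have "smooth_on U a'"
    unfolding a'_def p_def
    by (rule smooth_on_compose[OF \<open>open U\<close> \<open>open (U \<times> U)\<close> _ _ smooth_p])
       (use x0 \<open>open U\<close> in \<open>auto intro!: smooth_on_Pair smooth_on_ident smooth_on_const\<close>)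
  ultimately have ff: "frame_field U a a'"
    using \<open>open U\<close> x0 by (auto simp: frame_field_def a_def a'_def p_mult p_id)
  have P_eq: "P (u, w) = (u, w, a' w ** a u)" if "u \<in> U" "w \<in> U" for u w
    using that x0 by (simp add: P a_def a'_def p_mult)
  \<comment> \<open>Integrability is used at the diagonal pair \<open>(x0, x0)\<close>: from
    \<open>D1\<close> only the point \<open>x0\<close> matters, through which all jets are routed,
    while \<open>D2\<close> becomes the homogeneous set.\<close>
  obtain D1 D2 \<psi>1 \<psi>2 where D: "x0 \<in> D1" "D1 \<subseteq> U" "diffeo_on D1 (\<psi>1 ` D1) \<psi>1"
      "x0 \<in> D2" "D2 \<subseteq> U" "diffeo_on D2 (\<psi>2 ` D2) \<psi>2"
    and Q: "\<And>x y. x \<in> D1 \<Longrightarrow> y \<in> D2 \<Longrightarrow>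
      Q (x, y) = j1 x (inv_into D2 \<psi>2 \<circ> transl (\<psi>2 y - \<psi>1 x) \<circ> \<psi>1)"
    using int x0 unfolding integrable_section_def by metis
  have "open D2" using D(6) by (simp add: diffeo_on_def)
  then have ff2: "frame_field D2 a a'"
    using ff D(5) by (auto simp: frame_field_def intro: smooth_on_subset)
  define \<kappa> where "\<kappa> = (\<lambda>z :: frame. (\<psi>2 (fst z), a (fst z) ** snd z))"
  let ?d1 = "frechet_derivative \<psi>1 (at x0)" and ?e1 = "frechet_derivative (inv_into D1 \<psi>1) (at (\<psi>1 x0))"
  let ?d2 = "\<lambda>x. frechet_derivative \<psi>2 (at x)"
    and ?e2 = "\<lambda>y. frechet_derivative (inv_into D2 \<psi>2) (at (\<psi>2 y))"
  have pj: "pair_jet a a' x0 y (?e2 y \<circ> ?d1) \<in> ?\<Omega>" if y: "y \<in> D2" for y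
  proof -
    have "Q (x0, y) = (x0, y, matrix (?e2 y \<circ> ?d1))"
      using Q[OF D(1) y] j1_conj_transl[OF D(3,1) D(6) y] by simp
    moreover have "Q (x0, y) \<in> Pi1 U"
      using sec(2) x0 y D(5) by (auto simp: pi1_section_def)
    ultimately have "prolongation U P Q (x0, y) = pair_jet a a' x0 y ((*v) (matrix (?e2 y \<circ> ?d1)))"
      using prolongation_eq_pair_jet[OF ff P_eq x0] y D(5) by blast
    also have "(*v) (matrix (?e2 y \<circ> ?d1)) = ?e2 y \<circ> ?d1"
      by (rule matrix_vector_mul_frechet_derivative[OF has_derivative_conj_transl[OF D(3,1) D(6) y]])
    finally show ?thesis using \<Omega>[OF x0, of y] y D(5) by (metis subsetD)
  qed
  have "rjet x (inv_into (FB D2) \<kappa> \<circ> Fmap (transl (base_map \<kappa> y - base_map \<kappa> x)) \<circ> \<kappa>) \<in> ?\<Omega>"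
    if x: "x \<in> D2" and y: "y \<in> D2" for x y
  proof -
    have d1: "?e1 (?d1 v) = v" "?d1 (?e1 v) = v" for v
      using diffeo_on_derivative_inverse[OF D(3,1)] by (metis comp_apply id_apply)+
    have d2: "?e2 x (?d2 x v) = v" "?d2 x (?e2 x v) = v" for v
      using diffeo_on_derivative_inverse[OF D(6) x] by (metis comp_apply id_apply)+
    have "jinv (pair_jet a a' x0 x (?e2 x \<circ> ?d1)) = pair_jet a a' x x0 (?e1 \<circ> ?d2 x)"
      by (rule pair_jet_inv[OF ff2 D(4) x]) (auto simp: d1 d2)
    then have "pair_jet a a' x x0 (?e1 \<circ> ?d2 x) \<in> ?\<Omega>"
      using lie_subgroupoidD(5)[OF lie pj[OF x]] by simp
    then have "pair_jet a a' x0 y (?e2 y \<circ> ?d1) \<odot> pair_jet a a' x x0 (?e1 \<circ> ?d2 x) \<in> ?\<Omega>"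
      by (rule lie_subgroupoidD(4)[OF lie _ pj[OF y]]) (simp add: src_pair_jet tgt_pair_jet)
    also have "pair_jet a a' x0 y (?e2 y \<circ> ?d1) \<odot> pair_jet a a' x x0 (?e1 \<circ> ?d2 x) =
        pair_jet a a' x y (?e2 y \<circ> ?d2 x)"
      using pair_jet_comp[OF ff2 x D(4) y] by (simp add: comp_def d1)
    also have "\<dots> = rjet x (inv_into (FB D2) \<kappa> \<circ> Fmap (transl (base_map \<kappa> y - base_map \<kappa> x)) \<circ> \<kappa>)"
      by (rule rjet_conj_transl[OF ff2 D(6) _ x y, symmetric]) (simp add: \<kappa>_def)
    finally show ?thesis .
  qed
  moreover have "deformation D2 \<kappa>"
    unfolding \<kappa>_def by (rule deformation_of_chart[OF ff2 D(6)])
  ultimately have "homogeneous_set B W D2"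
    unfolding homogeneous_set_def by blast
  then show ?thesis using \<open>open D2\<close> D by blast
qed

section \<open>Base and transitivity of the material groupoid\<close>

text \<open>Serves to evaluate the definite descriptions \<open>src\<close> and \<open>tgt\<close>
  on arbitrary elements and to compose them by \<open>tri_jet_comp\<close>, which asks for an
  invertible \<open>A\<close>.\<close>

lemma Jt_normal_form:
  assumes "c \<in> Jt M"
  obtains x y F A B where "c = tri_jet x y F A B" "x \<in> M" "y \<in> M" "invertible A"
proof -
  obtain x \<Psi> U V where c: "c = rjet x \<Psi>" "local_pb_iso U V \<Psi>" "U \<subseteq> M" "V \<subseteq> M" "x \<in> U"
    using assms unfolding Jt_def by blast
  have U: "open U" and \<Psi>: "equivariant_on U \<Psi>" "smooth_on (FB U) \<Psi>" "\<Psi> ` FB U = FB V"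
    using c(2) by (auto simp: local_pb_iso_def diffeo_on_def bij_betw_def)
  then have "\<Psi> ` FB U \<subseteq> FB UNIV" by (auto simp: FB_def)
  note nf = equivariant_smooth_normal_form[OF U \<Psi>(1,2) this]
  have "c = tri_jet x (base_map \<Psi> x) (frechet_derivative (base_map \<Psi>) (at x))
      (snd (\<Psi> (x, mat 1))) (frechet_derivative (\<lambda>u. snd (\<Psi> (u, mat 1))) (at x))"
    unfolding c(1)
    by (rule rjet_eq_tri_jet[OF U c(5) nf(4) smooth_on_has_derivative[OF nf(1) c(5)]
          smooth_on_has_derivative[OF nf(2) c(5)]])
  moreover have "(x, mat 1) \<in> FB U" using c(5) by (simp add: FB_def invertible_mat_1)
  then have "\<Psi> (x, mat 1) \<in> FB V" using \<Psi>(3) by blast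
  then have "base_map \<Psi> x \<in> M"
    using c(4) unfolding base_map_def FB_def mem_Times_iff by blast
  ultimately show thesis using that nf(3)[OF c(5)] c(3,5) by blast
qed

lemma jinv_iff: "(Y, X, K) \<in> jinv c \<longleftrightarrow> (\<exists>L. K = inv L \<and> (X, Y, L) \<in> c)"
  unfolding jinv_def by blast

lemma src_jinv: "src (jinv c) = tgt c"
proof -
  have "(\<exists>A Y L. ((x, A), Y, L) \<in> jinv c) \<longleftrightarrow> (\<exists>X A L. (X, (x, A), L) \<in> c)" for x
    unfolding jinv_iff by blast
  then show ?thesis by (simp add: src_def tgt_def)
qed

lemma tgt_jinv: "tgt (jinv c) = src c"
proof -
  have "(\<exists>X A L. (X, (y, A), L) \<in> jinv c) \<longleftrightarrow> (\<exists>A Y L. ((y, A), Y, L) \<in> c)" for y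
    unfolding jinv_iff by blast
  then show ?thesis by (simp add: src_def tgt_def)
qed

lemma src_tgt_jcomp:
  assumes "c \<in> Jt M" "d \<in> Jt M" "src d = tgt c"
  shows "src (d \<odot> c) = src c" "tgt (d \<odot> c) = tgt d"
proof -
  obtain x y F A B where c: "c = tri_jet x y F A B" "invertible A"
    using assms(1) Jt_normal_form by metis
  obtain y' z F' A' B' where d: "d = tri_jet y' z F' A' B'"
    using assms(2) Jt_normal_form by metis
  have "y' = y" using assms(3) by (simp add: c d src_tri_jet tgt_tri_jet)
  then show "src (d \<odot> c) = src c" "tgt (d \<odot> c) = tgt d"
    using tri_jet_comp[OF c(2)] by (simp_all add: c(1) d src_tri_jet tgt_tri_jet)
qed

lemma jid_eq: "jid x = {((x, g), (x, g), id) | g. invertible g}"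
  by (simp add: jid_def rjet_eq fjet_def)

lemma src_jid: "src (jid x) = x" and tgt_jid: "tgt (jid x) = x"
proof -
  have "\<exists>g :: real^3^3. invertible g" using invertible_mat_1 by blast
  then show "src (jid x) = x" "tgt (jid x) = x" by (auto simp: src_def tgt_def jid_eq)
qed

text \<open>A unit composed on the right changes no jet of a deformation, so the two responses to be
  compared are the same term.\<close>

lemma jid_in_material_groupoid:
  assumes "open B" "x \<in> B"
  shows "jid x \<in> material_groupoid B W"
proof -
  have o: "open (FB B)" using assms(1) by (rule open_FB)
  have id: "smooth_on (FB B) (id :: frame \<Rightarrow> frame)"
    using smooth_on_ident[OF o] by (simp add: id_def)
  have "smooth_on (FB B) (inv_into (FB B) id)"
    by (rule smooth_on_cong[OF o _ id]) (metis id_apply inj_on_id inv_into_f_f)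
  then have "local_pb_iso B B id"
    using assms(1) o id by (simp add: local_pb_iso_def diffeo_on_def equivariant_on_def)
  then have "jid x \<in> Jt B"
    using assms(2) unfolding Jt_def jid_def by blast
  moreover have "rjet x \<kappa> \<odot> jid x = rjet x \<kappa>" for \<kappa>
    by (auto simp: jcomp_def jid_eq rjet_eq fjet_def)
  ultimately show ?thesis by (simp add: material_groupoid_def tgt_jid)
qed

lemma homogeneous_set_transitive:
  assumes "homogeneous_set B W U"
  shows "transitive_on U (material_groupoid B W)"
  unfolding transitive_on_def
proof (intro ballI)
  fix x y assume xy: "x \<in> U" "y \<in> U"
  obtain \<kappa> where \<kappa>: "deformation U \<kappa>"
    "rjet x (inv_into (FB U) \<kappa> \<circ> Fmap (transl (base_map \<kappa> y - base_map \<kappa> x)) \<circ> \<kappa>)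
        \<in> material_groupoid B W"
    using assms xy unfolding homogeneous_set_def by blast
  obtain k a a' where "frame_field U a a'" "diffeo_on U (k ` U) k"
    "\<And>z. z \<in> FB U \<Longrightarrow> \<kappa> z = (k (fst z), a (fst z) ** snd z)"
    using deformation_normal_form[OF \<kappa>(1)] by metis
  from rjet_conj_transl[OF this xy] \<kappa>(2)
  show "\<exists>c\<in>material_groupoid B W. src c = x \<and> tgt c = y"
    using src_pair_jet tgt_pair_jet by metis
qed

text \<open>Being joined by an arrow is symmetric by inverses and transitive by composites. Each
  homogeneous set lies in a single class, so the classes are open, and a connected body has only
  one.\<close>

lemma locally_homogeneous_transitive:
  assumes "connected B" "locally_homogeneous B W" "lie_subgroupoid B B (material_groupoid B W)"
  shows "transitive_on B (material_groupoid B W)"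
  unfolding transitive_on_def
proof (intro ballI)
  let ?\<Omega> = "material_groupoid B W"
  let ?R = "\<lambda>x y. \<exists>c\<in>?\<Omega>. src c = x \<and> tgt c = y"
  note Jt = lie_subgroupoidD(2)[OF assms(3)] and comp = lie_subgroupoidD(4)[OF assms(3)]
    and inv = lie_subgroupoidD(5)[OF assms(3)]
  fix x y assume "x \<in> B" "y \<in> B"
  with assms(1) show "?R x y"
  proof (rule connected_equivalence_relation)
    show "?R v u" if "?R u v" for u v
      using that inv by (auto intro!: bexI[of _ "jinv _"] simp: src_jinv tgt_jinv)
    show "?R u w" if uv: "?R u v" and vw: "?R v w" for u v w
    proof -
      obtain c where c: "c \<in> ?\<Omega>" "src c = u" "tgt c = v" using uv by blast
      obtain d where d: "d \<in> ?\<Omega>" "src d = v" "tgt d = w" using vw by blast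
      have "src d = tgt c" using c d by simp
      with comp[OF c(1) d(1)] src_tgt_jcomp[of c B d] Jt c d show ?thesis by blast
    qed
    fix u assume "u \<in> B"
    then obtain U where U: "open U" "U \<subseteq> B" "u \<in> U" "homogeneous_set B W U"
      using assms(2) unfolding locally_homogeneous_def by blast
    have "\<forall>v\<in>U. ?R u v"
      using homogeneous_set_transitive[OF U(4)] U(3) unfolding transitive_on_def by blast
    then show "\<exists>T. openin (top_of_set B) T \<and> u \<in> T \<and> (\<forall>v\<in>T. ?R u v)"
      using U by (intro exI[of _ U]) (auto simp: openin_open_eq open_openin_trans open_subset)
  qed
qed

theorem proposition9p1:
  fixes B :: "point set" and W :: "reduced_jet \<Rightarrow> 'v::real_normed_vector"
  assumes "open B"
    and "mechanical_response B W"
    and "\<exists>N. lie_subgroupoid B N (material_groupoid B W)"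
  shows "(homogeneous B W \<longrightarrow> integrable_prolongation B (material_groupoid B W)) \<and>
    (connected B \<or> transitive_on B (material_groupoid B W) \<longrightarrow>
       (locally_homogeneous B W \<longrightarrow> integrable_prolongation B (material_groupoid B W)) \<and>
       (multiplicative_integrable_prolongation B (material_groupoid B W)
          \<longleftrightarrow> locally_homogeneous B W))"
proof -
  let ?\<Omega> = "material_groupoid B W"
  obtain N where N: "lie_subgroupoid B N ?\<Omega>" using assms(3) by blast
  have "x \<in> N" if "x \<in> B" for x
    using lie_subgroupoidD(3)[OF N jid_in_material_groupoid[OF assms(1) that]] by (simp add: src_jid)
  moreover have "N \<subseteq> B" using lie_subgroupoidD(1)[OF N] .
  ultimately have "N = B" by blast
  with N have lie: "lie_subgroupoid B B ?\<Omega>" by simp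
  have mult_imp: "integrable_prolongation B ?\<Omega>" if "multiplicative_integrable_prolongation B ?\<Omega>"
    using that unfolding multiplicative_integrable_prolongation_def integrable_prolongation_def by blast
  have local_imp: "multiplicative_integrable_prolongation B ?\<Omega>"
    if lh: "locally_homogeneous B W" and tr: "transitive_on B ?\<Omega>"
    unfolding multiplicative_integrable_prolongation_def reduced_lie_subgroupoid_def
  proof (intro conjI ballI lie tr)
    fix x assume "x \<in> B"
    then obtain U where U: "open U" "U \<subseteq> B" "x \<in> U" "homogeneous_set B W U"
      using lh unfolding locally_homogeneous_def by blast
    show "\<exists>U. open U \<and> U \<subseteq> B \<and> x \<in> U \<and>
        (\<exists>P Q. multiplicative_section U P \<and> integrable_prolongation_in U ?\<Omega> P Q)"
      by (intro exI[of _ U] conjI U(1-3) homogeneous_set_prolongation[OF U(4)])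
  qed
  have "locally_homogeneous B W" if "homogeneous B W"
    using that assms(1) unfolding homogeneous_def locally_homogeneous_def by blast
  \<comment> \<open>A single homogeneous set covering \<open>B\<close> supplies arrows between all
    its points, which gives transitivity directly.\<close>
  then have 1: "integrable_prolongation B ?\<Omega>" if "homogeneous B W"
    using that mult_imp local_imp homogeneous_set_transitive unfolding homogeneous_def by blast
  have "locally_homogeneous B W" if mip: "multiplicative_integrable_prolongation B ?\<Omega>"
    unfolding locally_homogeneous_def
  proof
    fix x assume "x \<in> B"
    then obtain U P Q where "open U" "U \<subseteq> B" "x \<in> U" "multiplicative_section U P"
      "integrable_prolongation_in U ?\<Omega> P Q"
      using mip unfolding multiplicative_integrable_prolongation_def by blast
    then show "\<exists>U. open U \<and> U \<subseteq> B \<and> x \<in> U \<and> homogeneous_set B W U"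
      using multiplicative_prolongation_homogeneous_set[OF _ _ lie] by (meson order_trans)
  qed
  with 1 mult_imp local_imp locally_homogeneous_transitive[OF _ _ lie] show ?thesis by blast
qed

end
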